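(* Let $g\in G(A(\!(t)\!))\setminus G(A[[t]])$ and let $M$ be a positive integer. (1) Write $r(g)=m/n$ with $\gcd(m,n)=1$, $n\ge1$. Let $v\ge m+M$ be an integer, put $s=v/n$, and let $\sigma_s:A(\!(t)\!)\to A^u(\!(t^{1/n})\!)$ be given by $t\mapsto t(1+ut^{v/n})$. Then $$g^{-1}\sigma_s(g)\in\ker\Bigl(G\bigl(A^u[[t^{1/n}]]\bigr)\to G\bigl(A^u[[t^{1/n}]]/(t^{M/n})\bigr)\Bigr).$$ (2) If $r(g)=0$, then for every integer $s\ge M$, $$g^{-1}\sigma_s(g)\in\ker\Bigl(G\bigl(A^u[[t]]\bigr)\to G\bigl(A^u[t]/(t^M)\bigr)\Bigr).$$
   Context: Let $A$ be a commutative ring, $A[[t]]$ the power series ring and $A(\!(t)\!)=A[[t]][t^{-1}]$. For $n\ge1$ put $A[[t^{1/n}]]=A[[t]][y]/(y^n-t)$ and $A(\!(t^{1/n})\!)=A[[t^{1/n}]][t^{-1}]$. Let $A^u=A[u]$ be a polynomial ring. Every $r\in\mathbb{Q}_{\ge0}$ is written $r=m/n$ with $\gcd(m,n)=1$, $n\ge1$ (and $0=0/1$). Put $A_r=A^u[[t^{1/n}]]$ and $\mathcal{A}_r=A^u(\!(t^{1/n})\!)$. For $r\in\mathbb{Q}_{>0}$, let $\sigma_r:A(\!(t)\!)\to\mathcal{A}_r$ be the $t$-adically continuous $A$-algebra homomorphism with $t\mapsto t(1+ut^r)$. Let $G$ be an affine $A$-group scheme with a closed embedding $G\hookrightarrow\mathrm{SL}_{N,A}$.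 For a ring map $\sigma$, $\sigma(g)$ denotes the image of $g$ under $G(\sigma)$. Index: if $g\in G(A[[t]])$, set $r(g)=-1$. Otherwise $r(g)\in\mathbb{Q}_{\ge0}$ is the infimum in $\mathbb{R}$ of $\{r\in\mathbb{Q}_{>0}\mid g^{-1}\sigma_r(g)\in G(A_r)\}$. *)

theory Defs
  imports "HOL-Analysis.Analysis" "HOL-Library.Poly_Mapping"
    "HOL-Computational_Algebra.Polynomial" "HOL-Computational_Algebra.Formal_Laurent_Series"
begin

type_synonym ('v, 'a) mpoly = "('v \<Rightarrow>\<^sub>0 nat) \<Rightarrow>\<^sub>0 'a"

definition mpvar :: "'v \<Rightarrow> ('v, 'a::comm_ring_1) mpoly" where
  "mpvar v = Poly_Mapping.single (Poly_Mapping.single v 1) 1"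

definition mpconst :: "'a::comm_ring_1 \<Rightarrow> ('v, 'a) mpoly" where
  "mpconst c = Poly_Mapping.single 0 c"

text \<open>Evaluation of a polynomial with coefficients in A at a point of an A-algebra R,
  the structure map A \<rightarrow> R being phi.\<close>
definition mpeval :: "('a::comm_ring_1 \<Rightarrow> 'b::comm_ring_1) \<Rightarrow> ('v \<Rightarrow> 'b) \<Rightarrow> ('v, 'a) mpoly \<Rightarrow> 'b" where
  "mpeval phi x p = (\<Sum>mon\<in>Poly_Mapping.keys p. phi (Poly_Mapping.lookup p mon) * (\<Prod>w\<in>Poly_Mapping.keys mon. x w ^ Poly_Mapping.lookup mon w))"

inductive_set ideal_gen :: "'r::comm_ring_1 set \<Rightarrow> 'r set" for S where
  zero: "0 \<in> ideal_gen S"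
| gen: "s \<in> S \<Longrightarrow> s \<in> ideal_gen S"
| add: "a \<in> ideal_gen S \<Longrightarrow> b \<in> ideal_gen S \<Longrightarrow> a + b \<in> ideal_gen S"
| mult: "a \<in> ideal_gen S \<Longrightarrow> r * a \<in> ideal_gen S"

text \<open>G is the closed subscheme of SL_N cut out by the set of polynomials I in the
  matrix entries; G(R) for an A-algebra R (structure map phi).\<close>
definition G_points :: "('a::comm_ring_1 \<Rightarrow> 'b::comm_ring_1) \<Rightarrow> ('n::finite \<times> 'n, 'a) mpoly set
    \<Rightarrow> 'b^'n^'n \<Rightarrow> bool" where
  "G_points phi I X \<longleftrightarrow> det X = 1 \<and> (\<forall>p\<in>I. mpeval phi (\<lambda>(i,j). X $ i $ j) p = 0)"

text \<open>G is a subgroup scheme: unit, multiplication and inversion of SL_N restrict to G,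
  expressed on coordinate rings (universal points).\<close>
definition subgroup_scheme_SL :: "('n::finite \<times> 'n, 'a::comm_ring_1) mpoly set \<Rightarrow> bool" where
  "subgroup_scheme_SL I \<longleftrightarrow>
     G_points id I (mat 1 :: 'a^'n^'n)
   \<and> (let X = (\<chi> i j. mpvar (False, i, j)) :: ((bool \<times> 'n \<times> 'n), 'a) mpoly^'n^'n;
          Y = (\<chi> i j. mpvar (True, i, j)) :: ((bool \<times> 'n \<times> 'n), 'a) mpoly^'n^'n;
          J = ideal_gen ({mpeval mpconst (\<lambda>(i,j). X $ i $ j) q | q. q \<in> I}
                       \<union> {mpeval mpconst (\<lambda>(i,j). Y $ i $ j) q | q. q \<in> I}
                       \<union> {det X - 1, det Y - 1})
      in \<forall>p\<in>I. mpeval mpconst (\<lambda>(i,j). (X ** Y) $ i $ j) p \<in> J)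
   \<and> (let X = (\<chi> i j. mpvar (False, i, j)) :: ((bool \<times> 'n \<times> 'n), 'a) mpoly^'n^'n;
          Z = (\<chi> i j. mpvar (True, i, j)) :: ((bool \<times> 'n \<times> 'n), 'a) mpoly^'n^'n;
          J = ideal_gen ({mpeval mpconst (\<lambda>(i,j). X $ i $ j) q | q. q \<in> I}
                       \<union> {det X - 1}
                       \<union> {(X ** Z - mat 1) $ i $ j | i j. True})
      in \<forall>p\<in>I. mpeval mpconst (\<lambda>(i,j). Z $ i $ j) p \<in> J)"

text \<open>A^u = A[u] is 'a poly; A^u[[t^{1/n}]] is modelled as 'a poly fps in y = t^{1/n},
  A^u((t^{1/n})) as 'a poly fls in y; the inclusion A((t)) \<rightarrow> A^u((t^{1/n})) is t \<mapsto> y^n.\<close>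

definition iota :: "nat \<Rightarrow> 'a::comm_ring_1 fls \<Rightarrow> 'a poly fls" where
  "iota n f = Abs_fls (\<lambda>i. if int n dvd i then [:fls_nth f (i div int n):] else 0)"

definition liftc :: "'a::comm_ring_1 fps \<Rightarrow> 'a poly fps" where
  "liftc F = Abs_fps (\<lambda>i. [:fps_nth F i:])"

text \<open>t(1 + u t^{k/n}) written in y = t^{1/n}: y^n (1 + u y^k).\<close>
definition Tser :: "nat \<Rightarrow> nat \<Rightarrow> 'a::comm_ring_1 poly fps" where
  "Tser n k = fps_X ^ n * (1 + fps_const [:0, 1:] * fps_X ^ k)"

definition Winv :: "nat \<Rightarrow> 'a::comm_ring_1 poly fps" where
  "Winv k = (THE w. (1 + fps_const [:0, 1:] * fps_X ^ k) * w = 1)"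

text \<open>The t-adically continuous A-algebra map A((t)) \<rightarrow> A^u((t^{1/n})),
  t \<mapsto> t(1+u t^{k/n}): write f = t^{-e} F with F a power series; then
  sigma f = (y^n(1+uy^k))^{-e} F(y^n(1+uy^k)).\<close>
definition sigma :: "nat \<Rightarrow> nat \<Rightarrow> 'a::comm_ring_1 fls \<Rightarrow> 'a poly fls" where
  "sigma n k f = (let e = nat (- fls_subdegree f);
                      F = fls_regpart (fls_shift (- int e) f)
                  in fls_shift (int (n * e)) (fps_to_fls (Winv k ^ e * (liftc F oo Tser n k))))"

text \<open>g^{-1} sigma(g) in G(A^u((t^{1/n}))), for sigma: t \<mapsto> t(1+u t^{k/n}).\<close>
definition quot :: "nat \<Rightarrow> nat \<Rightarrow> 'a::comm_ring_1 fls^'n::finite^'n \<Rightarrow> 'a poly fls^'n^'n" where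
  "quot n k g = (\<chi> i j. iota n (matrix_inv g $ i $ j)) ** (\<chi> i j. sigma n k (g $ i $ j))"

definition in_G_fps :: "('n::finite \<times> 'n, 'a::comm_ring_1) mpoly set \<Rightarrow> 'a fls^'n^'n \<Rightarrow> bool" where
  "in_G_fps I g \<longleftrightarrow> (\<exists>h :: 'a fps^'n^'n. g = (\<chi> i j. fps_to_fls (h $ i $ j)) \<and> G_points fps_const I h)"

text \<open>Membership in G(A^u[[t^{1/n}]]) of an element of G(A^u((t^{1/n}))).\<close>
definition in_G_Ar :: "('n::finite \<times> 'n, 'a::comm_ring_1) mpoly set \<Rightarrow> 'a poly fls^'n^'n \<Rightarrow> bool" where
  "in_G_Ar I x \<longleftrightarrow> (\<exists>h :: 'a poly fps^'n^'n. x = (\<chi> i j. fps_to_fls (h $ i $ j))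
                        \<and> G_points (\<lambda>c. fps_const [:c:]) I h)"

text \<open>Membership in ker(G(A^u[[t^{1/n}]]) \<rightarrow> G(A^u[[t^{1/n}]]/(t^{M/n}))).\<close>
definition in_kernel :: "('n::finite \<times> 'n, 'a::comm_ring_1) mpoly set \<Rightarrow> nat \<Rightarrow> 'a poly fls^'n^'n \<Rightarrow> bool" where
  "in_kernel I M x \<longleftrightarrow> (\<exists>h :: 'a poly fps^'n^'n. x = (\<chi> i j. fps_to_fls (h $ i $ j))
                        \<and> G_points (\<lambda>c. fps_const [:c:]) I h
                        \<and> (\<forall>i j. \<forall>l<M. fps_nth ((h - mat 1) $ i $ j) l = 0))"

definition rindex :: "('n::finite \<times> 'n, 'a::comm_ring_1) mpoly set \<Rightarrow> 'a fls^'n^'n \<Rightarrow> real" where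
  "rindex I g = (if in_G_fps I g then -1
     else Inf {real m / real n | m n. 0 < m \<and> 0 < n \<and> coprime m n \<and> in_G_Ar I (quot n m g)})"

end

theory Submission
  imports Defs
begin

text \<open>
  Write g = t^{-e} G with G integral. Taylor expansion in u gives
  sigma_{k/n}(G) = \<Sum>_j u^j t^{kj/n} theta_j(G), where theta_j is t^j times the j-th Hasse
  derivative, so the coefficient of u^j t^{p/n} in (1 + u t^{k/n})^e g^{-1} sigma_{k/n}(g) is the
  coefficient of t^{(p - kj)/n} in H_j = g^{-1} t^{-e} theta_j(G), and H_0 = 1. Integrality of
  g^{-1} sigma_{m'/n'}(g) therefore says that H_j has no term t^l with n' l + m' j < 0. Since
  r(g) = m/n is an infimum, some such m'/n' lies below (m + 1)/n; then for v \<ge> m + M no term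
  u^j t^{(nl + vj)/n} with j \<ge> 1 has exponent below M/n, and the unit (1 + u t^{v/n})^{-e} is
  congruent to 1 as well. Part (2) is the case m = 0, n = 1.
\<close>

notation fls_nth (infixl \<open>$$\<close> 75)

section \<open>Ring homomorphisms and evaluation of polynomials\<close>

definition is_ring_hom :: "('a::comm_ring_1 \<Rightarrow> 'b::comm_ring_1) \<Rightarrow> bool" where
  "is_ring_hom f \<longleftrightarrow> f 0 = 0 \<and> f 1 = 1 \<and> (\<forall>a b. f (a + b) = f a + f b) \<and> (\<forall>a b. f (a * b) = f a * f b)"

lemma is_ring_homD:
  assumes "is_ring_hom f"
  shows "f 0 = 0" "f 1 = 1" "f (a + b) = f a + f b" "f (a * b) = f a * f b"
  using assms unfolding is_ring_hom_def by auto

lemma ring_hom_uminus: "is_ring_hom f \<Longrightarrow> f (- a) = - f a"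
  by (metis add.right_inverse add_eq_0_iff is_ring_homD(1,3))

lemma ring_hom_diff: "is_ring_hom f \<Longrightarrow> f (a - b) = f a - f b"
  by (metis diff_conv_add_uminus is_ring_homD(3) ring_hom_uminus)

lemma ring_hom_sum: "is_ring_hom f \<Longrightarrow> f (sum g S) = sum (\<lambda>x. f (g x)) S"
  by (induct S rule: infinite_finite_induct) (auto simp: is_ring_homD)

lemma ring_hom_prod: "is_ring_hom f \<Longrightarrow> f (prod g S) = prod (\<lambda>x. f (g x)) S"
  by (induct S rule: infinite_finite_induct) (auto simp: is_ring_homD)

lemma ring_hom_power: "is_ring_hom f \<Longrightarrow> f (a ^ n) = f a ^ n"
  by (induct n) (auto simp: is_ring_homD)

lemma ring_hom_of_int: "is_ring_hom f \<Longrightarrow> f (of_int z) = of_int z"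
proof -
  assume h: "is_ring_hom f"
  have nat: "f (of_nat n) = of_nat n" for n
    by (induct n) (auto simp: is_ring_homD[OF h])
  show ?thesis
  proof (cases z)
    case (nonneg n) then show ?thesis by (simp add: nat)
  next
    case (neg n)
    have "f (of_int z) = f (- of_nat (Suc n))" using neg by simp
    also have "\<dots> = - of_nat (Suc n)" by (simp only: ring_hom_uminus[OF h] nat)
    finally show ?thesis using neg by simp
  qed
qed

lemma is_ring_hom_comp: "is_ring_hom f \<Longrightarrow> is_ring_hom g \<Longrightarrow> is_ring_hom (g \<circ> f)"
  by (simp add: is_ring_hom_def)

definition monomial_eval :: "('v \<Rightarrow> 'b::comm_ring_1) \<Rightarrow> ('v \<Rightarrow>\<^sub>0 nat) \<Rightarrow> 'b" where
  "monomial_eval x m = (\<Prod>w\<in>Poly_Mapping.keys m. x w ^ Poly_Mapping.lookup m w)"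

lemma monomial_eval_superset:
  assumes "finite S" "Poly_Mapping.keys m \<subseteq> S"
  shows "monomial_eval x m = (\<Prod>w\<in>S. x w ^ Poly_Mapping.lookup m w)"
  unfolding monomial_eval_def
  by (rule prod.mono_neutral_left[OF assms]) (auto simp: in_keys_iff)

lemma monomial_eval_add: "monomial_eval x (a + b) = monomial_eval x a * monomial_eval x b"
proof -
  let ?S = "Poly_Mapping.keys a \<union> Poly_Mapping.keys b"
  have f: "finite ?S" by simp
  have "monomial_eval x (a + b) = (\<Prod>w\<in>?S. x w ^ Poly_Mapping.lookup (a+b) w)"
    by (rule monomial_eval_superset[OF f]) (use keys_add[of a b] in auto)
  also have "\<dots> = (\<Prod>w\<in>?S. x w ^ Poly_Mapping.lookup a w) * (\<Prod>w\<in>?S. x w ^ Poly_Mapping.lookup b w)"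
    by (simp add: lookup_add power_add prod.distrib)
  also have "\<dots> = monomial_eval x a * monomial_eval x b"
    by (subst (1 2) monomial_eval_superset[OF f]) auto
  finally show ?thesis .
qed

lemma monomial_eval_zero: "monomial_eval x 0 = 1" by (simp add: monomial_eval_def)

lemma mpeval_superset:
  assumes "finite S" "Poly_Mapping.keys p \<subseteq> S" "phi 0 = 0"
  shows "mpeval phi x p = (\<Sum>m\<in>S. phi (Poly_Mapping.lookup p m) * monomial_eval x m)"
  unfolding mpeval_def monomial_eval_def[symmetric]
  by (rule sum.mono_neutral_left[OF assms(1,2)]) (auto simp: in_keys_iff assms(3))

lemma mpeval_add:
  assumes "is_ring_hom phi"
  shows "mpeval phi x (p + q) = mpeval phi x p + mpeval phi x q"
proof -
  let ?S = "Poly_Mapping.keys p \<union> Poly_Mapping.keys q"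
  have f: "finite ?S" by simp
  have z: "phi 0 = 0" using is_ring_homD[OF assms] by simp
  have "mpeval phi x (p + q) = (\<Sum>m\<in>?S. phi (Poly_Mapping.lookup (p+q) m) * monomial_eval x m)"
    by (rule mpeval_superset) (use keys_add[of p q] z in auto)
  also have "\<dots> = (\<Sum>m\<in>?S. phi (Poly_Mapping.lookup p m) * monomial_eval x m) + (\<Sum>m\<in>?S. phi (Poly_Mapping.lookup q m) * monomial_eval x m)"
    by (simp add: lookup_add is_ring_homD[OF assms] distrib_right sum.distrib)
  also have "\<dots> = mpeval phi x p + mpeval phi x q"
    using mpeval_superset[of ?S p phi x] mpeval_superset[of ?S q phi x] z by auto
  finally show ?thesis .
qed

lemma mpeval_single:
  assumes "is_ring_hom phi"
  shows "mpeval phi x (Poly_Mapping.single m c) = phi c * monomial_eval x m"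
proof -
  have z: "phi 0 = 0" using is_ring_homD[OF assms] by simp
  have "mpeval phi x (Poly_Mapping.single m c) = (\<Sum>m'\<in>{m}. phi (Poly_Mapping.lookup (Poly_Mapping.single m c) m') * monomial_eval x m')"
    by (rule mpeval_superset) (use z in auto)
  then show ?thesis by simp
qed

lemma mpeval_sum:
  assumes "is_ring_hom phi"
  shows "mpeval phi x (sum f S) = (\<Sum>i\<in>S. mpeval phi x (f i))"
proof (induct S rule: infinite_finite_induct)
  case (infinite A) then show ?case by (simp add: mpeval_def)
next
  case empty then show ?case by (simp add: mpeval_def)
next
  case (insert a A) then show ?case by (simp add: mpeval_add[OF assms])
qed

lemma poly_mapping_sum_singles: "p = (\<Sum>m\<in>Poly_Mapping.keys p. Poly_Mapping.single m (Poly_Mapping.lookup p m))"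
  by (rule poly_mapping_eqI) (simp add: lookup_sum lookup_single when_def in_keys_iff)

lemma mpeval_mult:
  assumes "is_ring_hom phi"
  shows "mpeval phi x (p * q) = mpeval phi x p * mpeval phi x q"
proof -
  let ?P = "Poly_Mapping.keys p" and ?Q = "Poly_Mapping.keys q"
  have "p * q = (\<Sum>a\<in>?P. Poly_Mapping.single a (Poly_Mapping.lookup p a)) * (\<Sum>b\<in>?Q. Poly_Mapping.single b (Poly_Mapping.lookup q b))"
    by (subst (1) poly_mapping_sum_singles[of p], subst (1) poly_mapping_sum_singles[of q]) simp
  also have "\<dots> = (\<Sum>a\<in>?P. \<Sum>b\<in>?Q. Poly_Mapping.single (a + b) (Poly_Mapping.lookup p a * Poly_Mapping.lookup q b))"
    by (simp add: sum_distrib_left sum_distrib_right mult_single sum.swap[of _ ?Q ?P])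
  finally have pq: "p * q = \<dots>" .
  have "mpeval phi x (p * q) = (\<Sum>a\<in>?P. \<Sum>b\<in>?Q. phi (Poly_Mapping.lookup p a) * monomial_eval x a * (phi (Poly_Mapping.lookup q b) * monomial_eval x b))"
    unfolding pq by (simp add: mpeval_sum[OF assms] mpeval_single[OF assms] is_ring_homD[OF assms] monomial_eval_add mult_ac)
  also have "\<dots> = mpeval phi x p * mpeval phi x q"
    by (simp add: mpeval_def monomial_eval_def sum_product)
  finally show ?thesis .
qed

lemma mpeval_one:
  assumes "is_ring_hom phi"
  shows "mpeval phi x 1 = 1"
  using mpeval_single[OF assms, of x 0 1] by (simp add: monomial_eval_zero is_ring_homD[OF assms])

lemma mpeval_zero: "mpeval phi x 0 = 0"
  by (simp add: mpeval_def)

lemma is_ring_hom_mpeval: "is_ring_hom phi \<Longrightarrow> is_ring_hom (mpeval phi x)"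
  unfolding is_ring_hom_def by (simp add: mpeval_zero mpeval_one mpeval_add mpeval_mult is_ring_hom_def)

lemma mpeval_commute:
  assumes "is_ring_hom f"
  shows "f (mpeval phi x p) = mpeval (f \<circ> phi) (f \<circ> x) p"
  by (simp add: mpeval_def ring_hom_sum[OF assms] ring_hom_prod[OF assms] is_ring_homD[OF assms] ring_hom_power[OF assms])

lemma mpeval_mpvar:
  assumes "is_ring_hom phi"
  shows "mpeval phi x (mpvar v) = x v"
  unfolding mpvar_def using mpeval_single[OF assms, of x "Poly_Mapping.single v 1" 1]
  by (simp add: is_ring_homD[OF assms] monomial_eval_def)

lemma mpeval_mpconst:
  assumes "is_ring_hom phi"
  shows "mpeval phi x (mpconst c) = phi c"
  unfolding mpconst_def using mpeval_single[OF assms, of x 0 c]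
  by (simp add: monomial_eval_zero)

lemma mpeval_subst:
  assumes "is_ring_hom phi"
  shows "mpeval phi x (mpeval mpconst y q) = mpeval phi (\<lambda>v. mpeval phi x (y v)) q"
proof -
  have "mpeval phi x (mpeval mpconst y q) = mpeval (mpeval phi x \<circ> mpconst) (mpeval phi x \<circ> y) q"
    by (rule mpeval_commute[OF is_ring_hom_mpeval[OF assms]])
  also have "mpeval phi x \<circ> mpconst = phi"
    by (rule ext) (simp add: mpeval_mpconst[OF assms])
  finally show ?thesis by (simp add: comp_def)
qed

lemma ideal_gen_vanish:
  assumes "is_ring_hom f" "\<And>s. s \<in> S \<Longrightarrow> f s = 0" "a \<in> ideal_gen S"
  shows "f a = 0"
  using assms(3) by induct (auto simp: assms(2) is_ring_homD[OF assms(1)])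

lemma det_map_matrix:
  fixes A :: "'a::comm_ring_1^'n::finite^'n"
  assumes "is_ring_hom (f :: 'a \<Rightarrow> 'b::comm_ring_1)"
  shows "det (map_matrix f A) = f (det A)"
  unfolding det_def by (simp add: ring_hom_sum[OF assms] ring_hom_prod[OF assms] is_ring_homD[OF assms] ring_hom_of_int[OF assms])

lemma map_matrix_mult:
  fixes A B :: "'a::comm_ring_1^'n::finite^'n"
  assumes "is_ring_hom (f :: 'a \<Rightarrow> 'b::comm_ring_1)"
  shows "map_matrix f (A ** B) = map_matrix f A ** map_matrix f B"
  by (simp add: vec_eq_iff matrix_matrix_mult_def ring_hom_sum[OF assms] is_ring_homD[OF assms])

lemma map_matrix_mat_1:
  assumes "is_ring_hom (f :: 'a::comm_ring_1 \<Rightarrow> 'b::comm_ring_1)"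
  shows "map_matrix f (mat 1 :: 'a^'n^'n) = mat 1"
  by (simp add: vec_eq_iff mat_def is_ring_homD[OF assms])

section \<open>Matrices and points of G\<close>

definition adjugate :: "'a::comm_ring_1^'n::finite^'n \<Rightarrow> 'a^'n^'n" where
  "adjugate A = (\<chi> k j. det (\<chi> i. if i = j then axis k 1 else A $ i))"

lemma matrix_mult_adjugate:
  fixes A :: "'a::comm_ring_1^'n::finite^'n"
  shows "A ** adjugate A = mat (det A)"
proof -
  have "(A ** adjugate A) $ i $ j = (if i = j then det A else 0)" for i j
  proof -
    have "(A ** adjugate A) $ i $ j = (\<Sum>k\<in>UNIV. A$i$k * det (\<chi> r. if r = j then axis k 1 else A $ r))"
      by (simp add: matrix_matrix_mult_def adjugate_def)
    also have "\<dots> = (\<Sum>k\<in>UNIV. det (\<chi> r. if r = j then A$i$k *s axis k 1 else A $ r))"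
      by (simp add: det_row_mul)
    also have "\<dots> = det (\<chi> r. if r = j then (\<Sum>k\<in>UNIV. A$i$k *s axis k 1) else A $ r)"
      by (rule det_linear_row_sum[symmetric]) simp
    also have "(\<Sum>k\<in>UNIV. A$i$k *s axis k (1::'a)) = A $ i"
      by (simp add: vec_eq_iff sum_component axis_def mult.commute[of _ "if _ then _ else _"] if_distrib cong: if_cong)
    also have "det (\<chi> r. if r = j then A $ i else A $ r) = (if i = j then det A else 0)"
    proof (cases "i = j")
      case True
      then have "(\<chi> r. if r = j then A $ i else A $ r) = A" by (simp add: vec_eq_iff)
      then show ?thesis using True by simp
    next
      case False
      show ?thesis using False
        by (simp, intro det_identical_rows[OF False]) (simp add: row_def vec_eq_iff)
    qed
    finally show ?thesis .
  qed
  then show ?thesis by (simp add: vec_eq_iff mat_def)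
qed

lemma det_eq_1_matrix_inv:
  fixes A :: "'a::comm_ring_1^'n::finite^'n"
  assumes "det A = 1"
  shows "A ** matrix_inv A = mat 1 \<and> matrix_inv A ** A = mat 1"
proof -
  have r: "A ** adjugate A = mat 1" using matrix_mult_adjugate[of A] assms by simp
  have "det (adjugate A) = 1" using det_mul[of A "adjugate A"] r assms by simp
  then have r2: "adjugate A ** adjugate (adjugate A) = mat 1" using matrix_mult_adjugate[of "adjugate A"] by simp
  have "A = A ** (adjugate A ** adjugate (adjugate A))" by (simp add: r2)
  also have "\<dots> = adjugate (adjugate A)" by (simp add: matrix_mul_assoc r)
  finally have "adjugate A ** A = mat 1" using r2 by simp
  then have "\<exists>B. A ** B = mat 1 \<and> B ** A = mat 1" using r by blast
  then show ?thesis unfolding matrix_inv_def by (rule someI_ex)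
qed

lemma mpeval_subst_matrix:
  assumes "is_ring_hom phi"
  shows "mpeval phi x (mpeval mpconst (\<lambda>(i,j). M $ i $ j) q) = mpeval phi (\<lambda>(i,j). map_matrix (mpeval phi x) M $ i $ j) q"
proof -
  have "(\<lambda>v. mpeval phi x (case v of (i,j) \<Rightarrow> M $ i $ j)) = (\<lambda>(i,j). map_matrix (mpeval phi x) M $ i $ j)"
    by (rule ext) (auto split: prod.split)
  then show ?thesis by (simp add: mpeval_subst[OF assms])
qed

lemma map_matrix_mpvars:
  assumes "is_ring_hom phi"
  shows "map_matrix (mpeval phi x) ((\<chi> i j. mpvar (c, i, j)) :: ((bool \<times> 'n \<times> 'n), 'a::comm_ring_1) mpoly^'n::finite^'n)
    = (\<chi> i j. x (c, i, j))"
  by (simp add: vec_eq_iff mpeval_mpvar[OF assms])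

lemma G_points_mult:
  fixes I :: "('n::finite \<times> 'n, 'a::comm_ring_1) mpoly set" and phi :: "'a \<Rightarrow> 'b::comm_ring_1"
  assumes ph: "is_ring_hom phi" and S: "subgroup_scheme_SL I"
    and a: "G_points phi I a" and b: "G_points phi I b"
  shows "G_points phi I (a ** b)"
proof -
  define X where "X = ((\<chi> i j. mpvar (False, i, j)) :: ((bool \<times> 'n \<times> 'n), 'a) mpoly^'n^'n)"
  define Y where "Y = ((\<chi> i j. mpvar (True, i, j)) :: ((bool \<times> 'n \<times> 'n), 'a) mpoly^'n^'n)"
  define J where "J = ideal_gen ({mpeval mpconst (\<lambda>(i,j). X $ i $ j) q | q. q \<in> I}
                       \<union> {mpeval mpconst (\<lambda>(i,j). Y $ i $ j) q | q. q \<in> I}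
                       \<union> {det X - 1, det Y - 1})"
  have ax: "\<forall>p\<in>I. mpeval mpconst (\<lambda>(i,j). (X ** Y) $ i $ j) p \<in> J"
    using S unfolding subgroup_scheme_SL_def Let_def X_def Y_def J_def by blast
  define x where "x = (\<lambda>(c::bool, i::'n, j::'n). if c then b $ i $ j else a $ i $ j)"
  define E where "E = mpeval phi x"
  have E: "is_ring_hom E" unfolding E_def by (rule is_ring_hom_mpeval[OF ph])
  have EX: "map_matrix E X = a" unfolding E_def X_def by (simp add: map_matrix_mpvars[OF ph] x_def vec_eq_iff)
  have EY: "map_matrix E Y = b" unfolding E_def Y_def by (simp add: map_matrix_mpvars[OF ph] x_def vec_eq_iff)
  have ga: "\<forall>p\<in>I. mpeval phi (\<lambda>(i,j). a $ i $ j) p = 0" and da: "det a = 1"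
    using a unfolding G_points_def by auto
  have gb: "\<forall>p\<in>I. mpeval phi (\<lambda>(i,j). b $ i $ j) p = 0" and db: "det b = 1"
    using b unfolding G_points_def by auto
  have van: "E s = 0" if "s \<in> {mpeval mpconst (\<lambda>(i,j). X $ i $ j) q | q. q \<in> I}
                       \<union> {mpeval mpconst (\<lambda>(i,j). Y $ i $ j) q | q. q \<in> I}
                       \<union> {det X - 1, det Y - 1}" for s
    using that
    by (auto simp: E_def[symmetric] mpeval_subst_matrix[OF ph, of x, folded E_def] EX EY ga gb
        ring_hom_diff[OF E] det_map_matrix[OF E, symmetric] da db is_ring_homD[OF E])
  have "E (mpeval mpconst (\<lambda>(i,j). (X ** Y) $ i $ j) p) = 0" if "p \<in> I" for p
    using ideal_gen_vanish[OF E van] ax that unfolding J_def by blast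
  moreover have "E (mpeval mpconst (\<lambda>(i,j). (X ** Y) $ i $ j) p) = mpeval phi (\<lambda>(i,j). map_matrix E (X ** Y) $ i $ j) p" for p
    unfolding E_def by (rule mpeval_subst_matrix[OF ph])
  ultimately have "mpeval phi (\<lambda>(i,j). (a ** b) $ i $ j) p = 0" if "p \<in> I" for p
    using that by (metis map_matrix_mult[OF E] EX EY)
  moreover have "det (a ** b) = 1" by (simp add: det_mul da db)
  ultimately show ?thesis unfolding G_points_def by auto
qed

lemma G_points_matrix_inv:
  fixes I :: "('n::finite \<times> 'n, 'a::comm_ring_1) mpoly set" and phi :: "'a \<Rightarrow> 'b::comm_ring_1"
  assumes ph: "is_ring_hom phi" and S: "subgroup_scheme_SL I"
    and a: "G_points phi I a"
  shows "G_points phi I (matrix_inv a)"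
proof -
  define X where "X = ((\<chi> i j. mpvar (False, i, j)) :: ((bool \<times> 'n \<times> 'n), 'a) mpoly^'n^'n)"
  define Z where "Z = ((\<chi> i j. mpvar (True, i, j)) :: ((bool \<times> 'n \<times> 'n), 'a) mpoly^'n^'n)"
  define J where "J = ideal_gen ({mpeval mpconst (\<lambda>(i,j). X $ i $ j) q | q. q \<in> I}
                       \<union> {det X - 1}
                       \<union> {(X ** Z - mat 1) $ i $ j | i j. True})"
  have ax: "\<forall>p\<in>I. mpeval mpconst (\<lambda>(i,j). Z $ i $ j) p \<in> J"
    using S unfolding subgroup_scheme_SL_def Let_def X_def Z_def J_def by blast
  define b where "b = matrix_inv a"
  have ga: "\<forall>p\<in>I. mpeval phi (\<lambda>(i,j). a $ i $ j) p = 0" and da: "det a = 1"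
    using a unfolding G_points_def by auto
  have ab: "a ** b = mat 1" and ba: "b ** a = mat 1" using det_eq_1_matrix_inv[OF da] b_def by auto
  define x where "x = (\<lambda>(c::bool, i::'n, j::'n). if c then b $ i $ j else a $ i $ j)"
  define E where "E = mpeval phi x"
  have E: "is_ring_hom E" unfolding E_def by (rule is_ring_hom_mpeval[OF ph])
  have EX: "map_matrix E X = a" unfolding E_def X_def by (simp add: map_matrix_mpvars[OF ph] x_def vec_eq_iff)
  have EZ: "map_matrix E Z = b" unfolding E_def Z_def by (simp add: map_matrix_mpvars[OF ph] x_def vec_eq_iff)
  have EM: "E ((X ** Z - mat 1) $ i $ j) = 0" for i j
  proof -
    have "E ((X ** Z - mat 1) $ i $ j) = map_matrix E (X ** Z) $ i $ j - map_matrix E (mat 1) $ i $ j"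
      by (simp add: ring_hom_diff[OF E])
    also have "\<dots> = 0" by (simp only: map_matrix_mult[OF E] map_matrix_mat_1[OF E] EX EZ ab) simp
    finally show ?thesis .
  qed
  have EM': "E ((X ** Z) $ i $ j) = E (mat 1 $ i $ j)" for i j
    using EM[of i j] by (simp add: ring_hom_diff[OF E])
  have van: "E s = 0" if "s \<in> {mpeval mpconst (\<lambda>(i,j). X $ i $ j) q | q. q \<in> I}
                       \<union> {det X - 1}
                       \<union> {(X ** Z - mat 1) $ i $ j | i j. True}" for s
    using that
    by (auto simp: E_def[symmetric] mpeval_subst_matrix[OF ph, of x, folded E_def] EX ga EM EM'
        ring_hom_diff[OF E] det_map_matrix[OF E, symmetric] da is_ring_homD[OF E])
  have "E (mpeval mpconst (\<lambda>(i,j). Z $ i $ j) p) = 0" if "p \<in> I" for p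
    using ideal_gen_vanish[OF E van] ax that unfolding J_def by blast
  moreover have "E (mpeval mpconst (\<lambda>(i,j). Z $ i $ j) p) = mpeval phi (\<lambda>(i,j). map_matrix E Z $ i $ j) p" for p
    unfolding E_def by (rule mpeval_subst_matrix[OF ph])
  ultimately have "mpeval phi (\<lambda>(i,j). b $ i $ j) p = 0" if "p \<in> I" for p
    using that by (metis EZ)
  moreover have "det b = 1" using det_mul[of a b] ab da by simp
  ultimately show ?thesis unfolding G_points_def b_def by auto
qed

lemma G_points_map:
  fixes I :: "('n::finite \<times> 'n, 'a::comm_ring_1) mpoly set" and phi :: "'a \<Rightarrow> 'b::comm_ring_1"
    and f :: "'b \<Rightarrow> 'c::comm_ring_1"
  assumes f: "is_ring_hom f" and a: "G_points phi I a"
  shows "G_points (f \<circ> phi) I (map_matrix f a)"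
proof -
  have L: "(\<lambda>(i,j). map_matrix f a $ i $ j) = f \<circ> (\<lambda>(i,j). a $ i $ j)"
    by (rule ext) (auto split: prod.split)
  have eq: "mpeval (f \<circ> phi) (\<lambda>(i,j). map_matrix f a $ i $ j) p = f (mpeval phi (\<lambda>(i,j). a $ i $ j) p)" for p
    unfolding L by (rule mpeval_commute[OF f, symmetric])
  have d: "det (map_matrix f a) = 1" using a unfolding G_points_def by (simp add: det_map_matrix[OF f] is_ring_homD[OF f])
  have z: "\<forall>p\<in>I. mpeval phi (\<lambda>(i,j). a $ i $ j) p = 0" using a unfolding G_points_def by simp
  show ?thesis
    unfolding G_points_def
  proof (intro conjI ballI d)
    fix p assume "p \<in> I"
    then show "mpeval (f \<circ> phi) (\<lambda>(i,j). map_matrix f a $ i $ j) p = 0"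
      using eq[of p] z is_ring_homD(1)[OF f] by metis
  qed
qed

lemma G_points_reflect:
  fixes I :: "('n::finite \<times> 'n, 'a::comm_ring_1) mpoly set" and phi :: "'a \<Rightarrow> 'b::comm_ring_1"
    and f :: "'b \<Rightarrow> 'c::comm_ring_1"
  assumes f: "is_ring_hom f" and inj: "inj f" and a: "G_points (f \<circ> phi) I (map_matrix f a)"
  shows "G_points phi I a"
proof -
  have L: "(\<lambda>(i,j). map_matrix f a $ i $ j) = f \<circ> (\<lambda>(i,j). a $ i $ j)"
    by (rule ext) (auto split: prod.split)
  have "mpeval (f \<circ> phi) (\<lambda>(i,j). map_matrix f a $ i $ j) p = f (mpeval phi (\<lambda>(i,j). a $ i $ j) p)" for p
    unfolding L by (rule mpeval_commute[OF f, symmetric])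
  then have "f (mpeval phi (\<lambda>(i,j). a $ i $ j) p) = f 0" if "p \<in> I" for p
    using a that unfolding G_points_def by (metis is_ring_homD(1)[OF f])
  then have 1: "mpeval phi (\<lambda>(i,j). a $ i $ j) p = 0" if "p \<in> I" for p
    using inj that by (simp add: inj_eq)
  have "f (det a) = f 1" using a unfolding G_points_def by (simp add: det_map_matrix[OF f] is_ring_homD[OF f])
  then have "det a = 1" using inj by (simp add: inj_eq)
  then show ?thesis using 1 unfolding G_points_def by simp
qed

section \<open>Laurent series and the substitutions t \<mapsto> t(1 + u t^{k/n})\<close>

lemma fls_times_nth_bounds:
  fixes f g :: "'a::comm_ring_1 fls"
  assumes "\<And>i. i < d1 \<Longrightarrow> f $$ i = 0" "\<And>i. i < d2 \<Longrightarrow> g $$ i = 0"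
  shows "(f * g) $$ n = (\<Sum>i=d1..n-d2. f $$ i * g $$ (n - i))"
proof (cases "f = 0 \<or> g = 0")
  case True then show ?thesis by auto
next
  case False
  then have f: "f \<noteq> 0" and g: "g \<noteq> 0" by auto
  have df: "d1 \<le> fls_subdegree f" by (rule fls_subdegree_geI[OF f assms(1)])
  have dg: "d2 \<le> fls_subdegree g" by (rule fls_subdegree_geI[OF g assms(2)])
  have "(f * g) $$ n = (\<Sum>i=fls_subdegree f..n - fls_subdegree g. f $$ i * g $$ (n - i))"
    by (rule fls_times_nth(2))
  also have "\<dots> = (\<Sum>i=d1..n-d2. f $$ i * g $$ (n - i))"
    by (rule sum.mono_neutral_left) (use df dg in auto)
  finally show ?thesis .
qed

lemma fls_times_nth_neg:
  fixes f g :: "'a::comm_ring_1 fls"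
  assumes "\<And>i. i < 0 \<Longrightarrow> f $$ i = 0" "\<And>i. i < 0 \<Longrightarrow> g $$ i = 0" "n < 0"
  shows "(f * g) $$ n = 0"
  using fls_times_nth_bounds[of 0 f 0 g n, OF assms(1,2)] assms(3) by simp

definition fps_map :: "('a::comm_ring_1 \<Rightarrow> 'b::comm_ring_1) \<Rightarrow> 'a fps \<Rightarrow> 'b fps" where
  "fps_map h F = Abs_fps (\<lambda>i. h (F $ i))"

lemma fps_map_nth [simp]: "fps_map h F $ i = h (F $ i)"
  by (simp add: fps_map_def)

lemma is_ring_hom_fps_map: "is_ring_hom h \<Longrightarrow> is_ring_hom (fps_map h)"
  unfolding is_ring_hom_def by (simp add: fps_eq_iff fps_mult_nth ring_hom_sum[unfolded is_ring_hom_def] is_ring_hom_def)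

definition fls_map :: "('a::comm_ring_1 \<Rightarrow> 'b::comm_ring_1) \<Rightarrow> 'a fls \<Rightarrow> 'b fls" where
  "fls_map h f = Abs_fls (\<lambda>i. h (f $$ i))"

lemma fls_map_nth [simp]: "h 0 = 0 \<Longrightarrow> fls_map h f $$ i = h (f $$ i)"
  unfolding fls_map_def by (rule nth_Abs_fls_lower_bound[where N = "fls_subdegree f"]) simp

lemma is_ring_hom_fls_map:
  assumes h: "is_ring_hom h"
  shows "is_ring_hom (fls_map h)"
proof -
  have h0: "h 0 = 0" using is_ring_homD[OF h] by simp
  have m: "fls_map h (f * g) = fls_map h f * fls_map h g" for f g
  proof (rule fls_eqI)
    fix n
    have "(fls_map h f * fls_map h g) $$ n = (\<Sum>i=fls_subdegree f..n-fls_subdegree g. fls_map h f $$ i * fls_map h g $$ (n - i))"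
      by (rule fls_times_nth_bounds) (simp_all add: h0)
    also have "\<dots> = h ((f * g) $$ n)"
      by (simp add: h0 fls_times_nth(2) ring_hom_sum[OF h] is_ring_homD[OF h])
    finally show "fls_map h (f * g) $$ n = (fls_map h f * fls_map h g) $$ n" by (simp add: h0)
  qed
  show ?thesis unfolding is_ring_hom_def
    by (simp add: m fls_eq_iff h0 is_ring_homD[OF h])
qed

lemma inj_fls_map: "h 0 = 0 \<Longrightarrow> inj h \<Longrightarrow> inj (fls_map h)"
  by (auto simp: inj_def fls_eq_iff)

lemma is_ring_hom_fps_to_fls: "is_ring_hom (fps_to_fls :: 'a::comm_ring_1 fps \<Rightarrow> 'a fls)"
  unfolding is_ring_hom_def by (simp add: fls_times_fps_to_fls)

lemma is_ring_hom_const_poly: "is_ring_hom (\<lambda>c::'a::comm_ring_1. [:c:])"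
  unfolding is_ring_hom_def by simp

lemma is_ring_hom_fls_const:
  "is_ring_hom (fls_const :: 'a::comm_ring_1 \<Rightarrow> 'a fls)"
  unfolding is_ring_hom_def by (simp add: fls_plus_const)

(* The library proves the next three facts only over integral domains. *)

lemma product_composition_lemma_comm_ring:
  fixes a b c d :: "'a::comm_ring_1 fps"
  assumes c0: "c$0 = 0" and d0: "d$0 = 0"
  shows "((a oo c) * (b oo d))$n =
    sum (\<lambda>(k,m). a$k * b$m * (c^k * d^m) $ n) {(k,m). k + m \<le> n}"  (is "?l = ?r")
proof -
  let ?S = "{(k::nat, m::nat). k + m \<le> n}"
  have s: "?S \<subseteq> {0..n} \<times> {0..n}" by (simp add: subset_eq)
  have f: "finite {(k::nat, m::nat). k + m \<le> n}"
    by (auto intro: finite_subset[OF s])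
  have "?r = (\<Sum>(k, m) \<in> {(k, m). k + m \<le> n}. \<Sum>j = 0..n. a $ k * b $ m * (c ^ k $ j * d ^ m $ (n - j)))"
    by (simp add: fps_mult_nth sum_distrib_left)
  also have "\<dots> = (\<Sum>i = 0..n. \<Sum>(k,m)\<in>{(k,m). k+m \<le> n}. a $ k * c ^ k $ i * b $ m * d ^ m $ (n-i))"
    unfolding sum.swap [where A = "{0..n}"] by (auto simp add: field_simps intro: sum.cong)
  also have "... = (\<Sum>i = 0..n.
                    \<Sum>q = 0..i. \<Sum>j = 0..n - i. a $ q * c ^ q $ i * (b $ j * d ^ j $ (n - i)))"
    apply (rule sum.cong [OF refl])
    apply (simp add: sum.cartesian_product mult.assoc)
    apply (rule sum.mono_neutral_right[OF f], force)
    by clarsimp (metis c0 d0 leI startsby_zero_power_prefix mult_not_zero)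
  also have "\<dots> = ?l"
    by (simp add: fps_mult_nth fps_compose_nth sum_product)
  finally show ?thesis by simp
qed

lemma fps_compose_mult_distrib_comm_ring:
  fixes a b c :: "'a::comm_ring_1 fps"
  assumes c0: "c $ 0 = 0"
  shows "(a * b) oo c = (a oo c) * (b oo c)"
proof -
  have l: "((a oo c) * (b oo c))$n = sum (\<lambda>s. sum (\<lambda>i. a$i * b$(s - i) * (c^s) $ n) {0..s}) {0..n}" for n
    unfolding product_composition_lemma_comm_ring[OF c0 c0] power_add[symmetric]
    unfolding sum_pair_less_iff[where a = "\<lambda>k. a$k" and b="\<lambda>m. b$m" and c="\<lambda>s. (c ^ s)$n" and n = n] ..
  show ?thesis
  proof (rule fps_ext)
    fix n
    have "(a * b oo c) $ n = (\<Sum>s = 0..n. \<Sum>i = 0..s. a $ i * b $ (s - i) * c ^ s $ n)"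
      by (simp add: fps_compose_nth fps_mult_nth sum_distrib_right)
    then show "(a * b oo c) $ n = ((a oo c) * (b oo c)) $ n" by (simp only: l)
  qed
qed

lemma fps_compose_power_comm_ring:
  fixes a c :: "'a::comm_ring_1 fps"
  assumes c0: "c $ 0 = 0"
  shows "a ^ k oo c = (a oo c) ^ k"
  by (induct k) (simp_all add: fps_compose_mult_distrib_comm_ring[OF c0])

(* Substitution of T = y^n W (W a unit with inverse Wi) for t, after applying h to the
  coefficients: t^{-e} F \<mapsto> T^{-e} F(T) = y^{-ne} Wi^e F(T). *)
definition fls_subst :: "('a::comm_ring_1 \<Rightarrow> 'b::comm_ring_1) \<Rightarrow> nat \<Rightarrow> 'b fps \<Rightarrow> 'b fps \<Rightarrow> 'a fls \<Rightarrow> 'b fls" where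
  "fls_subst h n T Wi f = (let e = nat (- fls_subdegree f); F = fls_regpart (fls_shift (- int e) f)
     in fls_shift (int (n * e)) (fps_to_fls (Wi ^ e * (fps_map h F oo T))))"

lemma fls_regpart_shift_neg:
  fixes g :: "'a::comm_ring_1 fls"
  assumes "0 \<le> fls_subdegree g"
  shows "fls_regpart (fls_shift (- int k) g) = fps_X ^ k * fls_regpart g"
proof (rule fps_ext)
  fix i
  show "fls_regpart (fls_shift (- int k) g) $ i = (fps_X ^ k * fls_regpart g) $ i"
  proof (cases "i < k")
    case True
    then have "int i - int k < fls_subdegree g" using assms by linarith
    then show ?thesis using True by (simp add: fps_X_power_mult_nth)
  next
    case False
    then show ?thesis by (simp add: fps_X_power_mult_nth of_nat_diff)
  qed
qed

lemma fps_map_X: "is_ring_hom h \<Longrightarrow> fps_map h fps_X = fps_X"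
  by (simp add: fps_eq_iff is_ring_homD fps_X_def)

lemma fps_to_fls_Xpow_mult: "fps_to_fls (fps_X ^ m * Z) = fls_shift (- int m) (fps_to_fls (Z :: 'a::comm_ring_1 fps))"
  by (simp add: fls_times_fps_to_fls fps_to_fls_power fls_X_power_times_conv_shift)

locale fls_subst_hom =
  fixes h :: "'a::comm_ring_1 \<Rightarrow> 'b::comm_ring_1" and n :: nat and T W Wi :: "'b fps"
  assumes h: "is_ring_hom h" and n: "1 \<le> n" and T: "T = fps_X ^ n * W" and W: "W * Wi = 1"
begin

lemma T_nth_0: "T $ 0 = 0"
  using n by (simp add: T fps_X_power_mult_nth)

lemma fls_subst_eq_shift:
  assumes d: "- fls_subdegree f \<le> int d"
  shows "fls_subst h n T Wi f = fls_shift (int (n * d)) (fps_to_fls (Wi ^ d * (fps_map h (fls_regpart (fls_shift (- int d) f)) oo T)))"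
proof -
  define e where "e = nat (- fls_subdegree f)"
  define F where "F = fls_regpart (fls_shift (- int e) f)"
  have ed: "e \<le> d" using d unfolding e_def by linarith
  define k where "k = d - e"
  have dk: "d = e + k" using ed k_def by simp
  have sub: "0 \<le> fls_subdegree (fls_shift (- int e) f)"
    by (rule fls_shift_nonneg_subdegree) (simp add: e_def)
  have "fls_regpart (fls_shift (- int d) f) = fls_regpart (fls_shift (- int k) (fls_shift (- int e) f))"
    by (simp add: dk algebra_simps)
  also have "\<dots> = fps_X ^ k * F" unfolding F_def by (rule fls_regpart_shift_neg[OF sub])
  finally have Fd: "fls_regpart (fls_shift (- int d) f) = fps_X ^ k * F" .
  have "fps_map h (fps_X ^ k * F) oo T = (fps_X oo T) ^ k * (fps_map h F oo T)"
    using is_ring_homD[OF is_ring_hom_fps_map[OF h]] ring_hom_power[OF is_ring_hom_fps_map[OF h]]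
    by (simp add: fps_map_X[OF h] fps_compose_mult_distrib_comm_ring[OF T_nth_0] fps_compose_power_comm_ring[OF T_nth_0])
  also have "\<dots> = fps_X ^ (n * k) * W ^ k * (fps_map h F oo T)"
    using T_nth_0 by (simp add: T power_mult_distrib power_mult)
  finally have C: "fps_map h (fps_X ^ k * F) oo T = fps_X ^ (n * k) * W ^ k * (fps_map h F oo T)" .
  have "Wi ^ d * (fps_X ^ (n * k) * W ^ k * (fps_map h F oo T)) = fps_X ^ (n * k) * (Wi ^ e * (fps_map h F oo T)) * (W * Wi) ^ k"
    by (simp add: dk power_add power_mult_distrib mult_ac)
  also have "\<dots> = fps_X ^ (n * k) * (Wi ^ e * (fps_map h F oo T))" by (simp add: W)
  finally have C2: "Wi ^ d * (fps_X ^ (n * k) * W ^ k * (fps_map h F oo T)) = \<dots>" .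
  have "fls_shift (int (n * d)) (fps_to_fls (Wi ^ d * (fps_map h (fls_regpart (fls_shift (- int d) f)) oo T)))
      = fls_shift (int (n * d)) (fls_shift (- int (n * k)) (fps_to_fls (Wi ^ e * (fps_map h F oo T))))"
    by (simp only: Fd C C2 fps_to_fls_Xpow_mult)
  also have "\<dots> = fls_shift (int (n * e)) (fps_to_fls (Wi ^ e * (fps_map h F oo T)))"
    by (simp add: dk algebra_simps)
  also have "\<dots> = fls_subst h n T Wi f" by (simp add: fls_subst_def Let_def e_def F_def)
  finally show ?thesis by simp
qed

lemma fls_subst_add: "fls_subst h n T Wi (f + g) = fls_subst h n T Wi f + fls_subst h n T Wi g"
proof -
  define d where "d = max (nat (- fls_subdegree f)) (nat (- fls_subdegree g))"
  have df: "- fls_subdegree f \<le> int d" and dg: "- fls_subdegree g \<le> int d" unfolding d_def by linarith+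
  have dfg: "- fls_subdegree (f + g) \<le> int d"
  proof (cases "f + g = 0")
    case True then show ?thesis by simp
  next
    case False then show ?thesis using fls_plus_subdegree[OF False] df dg by linarith
  qed
  show ?thesis
    unfolding fls_subst_eq_shift[OF dfg] fls_subst_eq_shift[OF df] fls_subst_eq_shift[OF dg]
    by (simp add: is_ring_homD[OF is_ring_hom_fps_map[OF h]] fps_compose_add_distrib distrib_left)
qed

lemma fls_subst_mult: "fls_subst h n T Wi (f * g) = fls_subst h n T Wi f * fls_subst h n T Wi g"
proof -
  define d1 where "d1 = nat (- fls_subdegree f)"
  define d2 where "d2 = nat (- fls_subdegree g)"
  have df: "- fls_subdegree f \<le> int d1" unfolding d1_def by linarith
  have dg: "- fls_subdegree g \<le> int d2" unfolding d2_def by linarith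
  have dfg: "- fls_subdegree (f * g) \<le> int (d1 + d2)"
  proof (cases "f * g = 0")
    case True then show ?thesis by simp
  next
    case False then show ?thesis using fls_mult_subdegree_ge[OF False] df dg by linarith
  qed
  have s1: "0 \<le> fls_subdegree (fls_shift (- int d1) f)" by (rule fls_shift_nonneg_subdegree) (use df in simp)
  have s2: "0 \<le> fls_subdegree (fls_shift (- int d2) g)" by (rule fls_shift_nonneg_subdegree) (use dg in simp)
  have R: "fls_regpart (fls_shift (- int (d1 + d2)) (f * g)) = fls_regpart (fls_shift (- int d1) f) * fls_regpart (fls_shift (- int d2) g)"
    using fls_times_conv_regpart[OF s1 s2] fls_times_both_shifted_simp[of "- int d1" f "- int d2" g]
    by (simp add: algebra_simps)
  have S: "fls_shift (int (n * (d1 + d2))) (A * B) = fls_shift (int (n * d1)) A * fls_shift (int (n * d2)) B" for A B :: "'b fls"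
    using fls_times_both_shifted_simp[of "int (n * d1)" A "int (n * d2)" B] by (simp add: algebra_simps)
  show ?thesis
    unfolding fls_subst_eq_shift[OF dfg] fls_subst_eq_shift[OF df] fls_subst_eq_shift[OF dg] R
    by (simp add: is_ring_homD[OF is_ring_hom_fps_map[OF h]] fps_compose_mult_distrib_comm_ring[OF T_nth_0] power_add fls_times_fps_to_fls
        fls_times_both_shifted_simp algebra_simps)
qed

lemma fls_subst_one: "fls_subst h n T Wi 1 = 1"
  by (simp add: fls_subst_def is_ring_homD[OF is_ring_hom_fps_map[OF h]])

lemma is_ring_hom_fls_subst: "is_ring_hom (fls_subst h n T Wi)"
proof -
  have "fls_subst h n T Wi 0 = 0"
    using fls_subst_add[of 0 0] by simp
  then show ?thesis unfolding is_ring_hom_def using fls_subst_add fls_subst_mult fls_subst_one by simp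
qed

lemma fls_subst_const: "fls_subst h n T Wi (fls_const c) = fls_const (h c)"
proof -
  have "fps_map h (fps_const c) = fps_const (h c)"
    by (simp add: fps_eq_iff is_ring_homD[OF h])
  then show ?thesis by (simp add: fls_subst_def)
qed

lemma fls_subst_X: "fls_subst h n T Wi fls_X = fps_to_fls T"
proof -
  have "fls_subdegree (fls_X :: 'a fls) = 1" by simp
  then show ?thesis by (simp add: fls_subst_def fps_map_X[OF h] T_nth_0)
qed

end

abbreviation unit_series :: "nat \<Rightarrow> 'a::comm_ring_1 poly fps" where
  "unit_series k \<equiv> 1 + fps_const [:0, 1:] * fps_X ^ k"

lemma unit_series_Winv:
  assumes k: "1 \<le> k"
  shows "unit_series k * Winv k = (1 :: 'a::comm_ring_1 poly fps)"
proof -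
  have W0: "(unit_series k :: 'a poly fps) $ 0 * 1 = 1" using k by simp
  have ex: "\<exists>w. unit_series k * w = (1 :: 'a poly fps)"
    using fps_right_inverse[OF W0] by blast
  have uniq: "w1 = w2" if "unit_series k * w1 = 1" "unit_series k * w2 = (1 :: 'a poly fps)" for w1 w2
  proof -
    have "w1 = w1 * (unit_series k * w2)" using that by simp
    also have "\<dots> = (unit_series k * w1) * w2" by (simp add: mult_ac)
    finally show ?thesis using that by simp
  qed
  show ?thesis unfolding Winv_def
    by (rule theI'[of "\<lambda>w. unit_series k * w = 1"]) (use ex uniq in blast)
qed

lemma sigma_eq_fls_subst: "sigma n k = fls_subst (\<lambda>c. [:c:]) n (Tser n k) (Winv k)"
  by (rule ext) (simp add: sigma_def fls_subst_def liftc_def fps_map_def)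

lemma fls_subst_hom_sigma:
  assumes "1 \<le> n" "1 \<le> k"
  shows "fls_subst_hom (\<lambda>c::'a::comm_ring_1. [:c:]) n (Tser n k) (unit_series k) (Winv k)"
  by (unfold_locales) (use assms unit_series_Winv in \<open>simp_all add: is_ring_hom_const_poly Tser_def\<close>)

lemma fls_subst_hom_iota:
  assumes "1 \<le> n"
  shows "fls_subst_hom (\<lambda>c::'a::comm_ring_1. [:c:]) n (fps_X ^ n) 1 1"
  by (unfold_locales) (use assms in \<open>simp_all add: is_ring_hom_const_poly\<close>)

lemma fps_compose_X_power_nth:
  assumes n: "1 \<le> n"
  shows "(G oo fps_X ^ n) $ p = (if n dvd p then G $ (p div n) else (0::'b::comm_ring_1))"
proof -
  have c: "(p = n * i) \<longleftrightarrow> (n dvd p \<and> i = p div n)" for i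
    using n by auto
  have "(G oo fps_X ^ n) $ p = (\<Sum>i=0..p. G $ i * (if p = n * i then 1 else 0))"
    by (simp add: fps_compose_nth power_mult[symmetric])
  also have "\<dots> = (\<Sum>i=0..p. if n dvd p \<and> i = p div n then G $ i else 0)"
    by (rule sum.cong) (auto simp: c)
  also have "\<dots> = (if n dvd p then G $ (p div n) else 0)"
    by (cases "n dvd p") (auto simp: div_le_dividend)
  finally show ?thesis .
qed

lemma iota_nth:
  assumes n: "1 \<le> n"
  shows "iota n f $$ q = (if int n dvd q then [:f $$ (q div int n):] else 0)"
  unfolding iota_def
proof (rule nth_Abs_fls_lower_bound[where N = "int n * fls_subdegree f"], intro allI impI)
  fix i assume i: "i < int n * fls_subdegree f"
  show "(if int n dvd i then [:f $$ (i div int n):] else 0) = 0"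
  proof (cases "int n dvd i")
    case True
    then obtain t where t: "i = int n * t" by blast
    then have "t < fls_subdegree f" using i n by (simp add: mult_less_cancel_left)
    then show ?thesis using True t n by simp
  qed simp
qed

lemma iota_eq_fls_subst:
  assumes n: "1 \<le> n"
  shows "iota n = fls_subst (\<lambda>c::'a::comm_ring_1. [:c:]) n (fps_X ^ n) 1"
proof (rule ext, rule fls_eqI)
  fix f :: "'a fls" and q
  define e where "e = nat (- fls_subdegree f)"
  define F where "F = fls_regpart (fls_shift (- int e) f)"
  have eq: "fls_subst (\<lambda>c. [:c:]) n (fps_X ^ n) 1 f $$ q = fps_to_fls (fps_map (\<lambda>c. [:c:]) F oo fps_X ^ n) $$ (q + int n * int e)"
    by (simp add: fls_subst_def e_def F_def Let_def)
  have ef: "- int e \<le> fls_subdegree f" unfolding e_def by linarith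
  show "iota n f $$ q = fls_subst (\<lambda>c. [:c:]) n (fps_X ^ n) 1 f $$ q"
  proof (cases "int n dvd q")
    case True
    then obtain t where t: "q = int n * t" by blast
    have qq: "q + int n * int e = int n * (t + int e)" by (simp add: t algebra_simps)
    show ?thesis
    proof (cases "t + int e < 0")
      case True
      then have "t < fls_subdegree f" using ef by linarith
      moreover have "int n * (t + int e) < 0" using True n by (simp add: mult_less_0_iff)
      ultimately show ?thesis using n True
        by (simp add: eq[unfolded t] qq[unfolded t] iota_nth t)
    next
      case False
      define s where "s = nat (t + int e)"
      have s: "t + int e = int s" using False s_def by simp
      have "fls_subst (\<lambda>c. [:c:]) n (fps_X ^ n) 1 f $$ q = fps_to_fls (fps_map (\<lambda>c. [:c:]) F oo fps_X ^ n) $$ (int (n * s))"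
        by (simp add: eq qq s)
      also have "\<dots> = [:F $ s:]" using n by (simp add: fps_compose_X_power_nth del: of_nat_mult)
      also have "\<dots> = [:f $$ t:]" by (simp add: F_def flip: s)
      finally show ?thesis using True t n by (simp add: iota_nth)
    qed
  next
    case False
    have nd: "\<not> n dvd nat (q + int n * int e)" if "0 \<le> q + int n * int e"
    proof
      assume "n dvd nat (q + int n * int e)"
      then have "int n dvd q + int n * int e" using that by (metis int_dvd_int_iff nat_0_le)
      then have "int n dvd q" by (simp add: dvd_add_left_iff)
      then show False using False by simp
    qed
    show ?thesis using n False nd
      by (simp add: eq iota_nth fps_compose_X_power_nth)
  qed
qed

lemma is_ring_hom_iota: "1 \<le> n \<Longrightarrow> is_ring_hom (iota n :: 'a::comm_ring_1 fls \<Rightarrow> 'a poly fls)"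
  using fls_subst_hom.is_ring_hom_fls_subst[OF fls_subst_hom_iota] iota_eq_fls_subst by metis

lemma is_ring_hom_sigma: "1 \<le> n \<Longrightarrow> 1 \<le> k \<Longrightarrow> is_ring_hom (sigma n k :: 'a::comm_ring_1 fls \<Rightarrow> 'a poly fls)"
  using fls_subst_hom.is_ring_hom_fls_subst[OF fls_subst_hom_sigma] sigma_eq_fls_subst by metis

lemma iota_const: "1 \<le> n \<Longrightarrow> iota n (fls_const c) = fls_const [:c:]"
  using fls_subst_hom.fls_subst_const[OF fls_subst_hom_iota] iota_eq_fls_subst by metis

lemma sigma_const: "1 \<le> n \<Longrightarrow> 1 \<le> k \<Longrightarrow> sigma n k (fls_const c) = fls_const [:c:]"
  using fls_subst_hom.fls_subst_const[OF fls_subst_hom_sigma] sigma_eq_fls_subst by metis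

lemma iota_X: "1 \<le> n \<Longrightarrow> iota n (fls_X :: 'a::comm_ring_1 fls) = fls_X ^ n"
  using fls_subst_hom.fls_subst_X[OF fls_subst_hom_iota] iota_eq_fls_subst by (metis fps_X_to_fls fps_to_fls_power)

lemma sigma_X: "1 \<le> n \<Longrightarrow> 1 \<le> k \<Longrightarrow> sigma n k (fls_X :: 'a::comm_ring_1 fls) = fps_to_fls (Tser n k)"
  using fls_subst_hom.fls_subst_X[OF fls_subst_hom_sigma] sigma_eq_fls_subst by metis

section \<open>Expansion in u\<close>

definition fls_ucoeff :: "nat \<Rightarrow> 'a::comm_ring_1 poly fls \<Rightarrow> 'a fls" where
  "fls_ucoeff j Y = Abs_fls (\<lambda>p. poly.coeff (Y $$ p) j)"

lemma fls_ucoeff_nth [simp]: "fls_ucoeff j Y $$ p = poly.coeff (Y $$ p) j"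
  unfolding fls_ucoeff_def by (rule nth_Abs_fls_lower_bound[where N = "fls_subdegree Y"]) simp

lemma fls_ucoeff_add: "fls_ucoeff j (Y + Z) = fls_ucoeff j Y + fls_ucoeff j Z"
  by (simp add: fls_eq_iff)

lemma fls_ucoeff_zero: "fls_ucoeff j 0 = 0"
  by (simp add: fls_eq_iff)

lemma fls_ucoeff_sum: "fls_ucoeff j (sum f S) = (\<Sum>i\<in>S. fls_ucoeff j (f i))"
  by (induct S rule: infinite_finite_induct) (simp_all add: fls_ucoeff_zero fls_ucoeff_add)

abbreviation const_poly_fls :: "'a::comm_ring_1 fls \<Rightarrow> 'a poly fls" where
  "const_poly_fls \<equiv> fls_map (\<lambda>c. [:c:])"

lemma fls_ucoeff_const_poly_mult: "fls_ucoeff j (const_poly_fls a * Y) = a * fls_ucoeff j Y"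
proof (rule fls_eqI)
  fix p
  have "(const_poly_fls a * Y) $$ p = (\<Sum>i=fls_subdegree a..p - fls_subdegree Y. const_poly_fls a $$ i * Y $$ (p - i))"
    by (rule fls_times_nth_bounds) simp_all
  moreover have "(a * fls_ucoeff j Y) $$ p = (\<Sum>i=fls_subdegree a..p - fls_subdegree Y. a $$ i * fls_ucoeff j Y $$ (p - i))"
    by (rule fls_times_nth_bounds) simp_all
  ultimately show "fls_ucoeff j (const_poly_fls a * Y) $$ p = (a * fls_ucoeff j Y) $$ p"
    by (simp add: coeff_sum)
qed

definition fls_spread :: "nat \<Rightarrow> 'a::comm_ring_1 fls \<Rightarrow> 'a fls" where
  "fls_spread n f = Abs_fls (\<lambda>i. if int n dvd i then f $$ (i div int n) else 0)"

lemma fls_spread_nth: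
  assumes n: "1 \<le> n"
  shows "fls_spread n f $$ q = (if int n dvd q then f $$ (q div int n) else 0)"
  unfolding fls_spread_def
proof (rule nth_Abs_fls_lower_bound[where N = "int n * fls_subdegree f"], intro allI impI)
  fix i assume i: "i < int n * fls_subdegree f"
  show "(if int n dvd i then f $$ (i div int n) else 0) = 0"
  proof (cases "int n dvd i")
    case True
    then obtain t where t: "i = int n * t" by blast
    then have "t < fls_subdegree f" using i n by (simp add: mult_less_cancel_left)
    then show ?thesis using True t n by simp
  qed simp
qed

lemma iota_eq_fls_spread: "1 \<le> n \<Longrightarrow> iota n f = const_poly_fls (fls_spread n f)"
  by (rule fls_eqI) (simp add: iota_nth fls_spread_nth)

lemma inj_const_poly_fls: "inj (const_poly_fls :: 'a::comm_ring_1 fls \<Rightarrow> 'a poly fls)"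
  by (rule inj_fls_map) (auto simp: inj_def)

lemma is_ring_hom_pullback:
  assumes p: "is_ring_hom p" and inj: "inj p" and pf: "is_ring_hom (p \<circ> f)"
  shows "is_ring_hom f"
  unfolding is_ring_hom_def
proof (intro conjI allI; rule injD[OF inj])
  fix a b
  show "p (f 0) = p 0" "p (f 1) = p 1" "p (f (a + b)) = p (f a + f b)" "p (f (a * b)) = p (f a * f b)"
    using is_ring_homD[OF p] is_ring_homD[OF pf] by simp_all
qed

lemma is_ring_hom_fls_spread:
  assumes n: "1 \<le> n"
  shows "is_ring_hom (fls_spread n :: 'a::comm_ring_1 fls \<Rightarrow> 'a fls)"
proof (rule is_ring_hom_pullback[OF is_ring_hom_fls_map[OF is_ring_hom_const_poly] inj_const_poly_fls])
  have "const_poly_fls \<circ> fls_spread n = (iota n :: 'a fls \<Rightarrow> 'a poly fls)"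
    by (rule ext) (simp add: iota_eq_fls_spread[OF n])
  then show "is_ring_hom (const_poly_fls \<circ> fls_spread n :: 'a fls \<Rightarrow> 'a poly fls)"
    using is_ring_hom_iota[OF n] by simp
qed

(* t^j times the j-th Hasse derivative. *)
definition fps_theta :: "nat \<Rightarrow> 'a::comm_ring_1 fps \<Rightarrow> 'a fps" where
  "fps_theta j F = Abs_fps (\<lambda>i. of_nat (i choose j) * F $ i)"

lemma fps_theta_nth [simp]: "fps_theta j F $ i = of_nat (i choose j) * F $ i"
  by (simp add: fps_theta_def)

lemma fps_theta_0 [simp]: "fps_theta 0 F = F"
  by (simp add: fps_eq_iff)

lemma coeff_unit_series_power:
  assumes k: "1 \<le> k"
  shows "poly.coeff ((unit_series k ^ i :: 'a::comm_ring_1 poly fps) $ q) j = (if q = k * j then of_nat (i choose j) else 0)"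
proof (induct i arbitrary: q j)
  case 0
  show ?case using k by (cases j) (auto simp: coeff_1)
next
  case (Suc i)
  have e: "(unit_series k ^ Suc i :: 'a poly fps) = unit_series k ^ i + fps_const [:0, 1:] * (fps_X ^ k * unit_series k ^ i)"
    by (simp add: algebra_simps)
  have cs: "poly.coeff ((unit_series k ^ Suc i :: 'a poly fps) $ q) j = poly.coeff ((unit_series k ^ i) $ q) j
     + poly.coeff ((fps_const [:0, 1:] * (fps_X ^ k * unit_series k ^ i) :: 'a poly fps) $ q) j"
    by (simp only: e fps_add_nth coeff_add)
  have "(fps_const [:0, 1:] * (fps_X ^ k * unit_series k ^ i) :: 'a poly fps) $ q =
        [:0, 1:] * (if q < k then 0 else (unit_series k ^ i) $ (q - k))"
    by (simp add: fps_X_power_mult_nth)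
  then have c2: "poly.coeff ((fps_const [:0, 1:] * (fps_X ^ k * unit_series k ^ i) :: 'a poly fps) $ q) j =
      (if j = 0 \<or> q < k then 0 else poly.coeff ((unit_series k ^ i) $ (q - k)) (j - 1))"
    by (cases j) auto
  show ?case
  proof (cases "j = 0 \<or> q < k")
    case True
    then show ?thesis
    proof
      assume j: "j = 0" then show ?thesis using c2 Suc cs by simp
    next
      assume q: "q < k"
      then have "q = k * j \<longleftrightarrow> j = 0 \<and> q = 0" using k by (cases j) auto
      then show ?thesis using c2 Suc q cs by auto
    qed
  next
    case False
    then obtain j' where j': "j = Suc j'" by (cases j) auto
    have kj: "k * j = k + k * j'" by (simp add: j')
    have qk: "q - k = k * j' \<longleftrightarrow> q = k * j" using False kj by linarith
    show ?thesis using c2 Suc False qk cs by (simp add: j')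
  qed
qed

lemma sigma_fps:
  assumes "1 \<le> n" "1 \<le> k"
  shows "sigma n k (fps_to_fls F) = fps_to_fls (fps_map (\<lambda>c::'a::comm_ring_1. [:c:]) F oo Tser n k)"
proof -
  have "nat (- fls_subdegree (fps_to_fls F)) = 0" using fls_subdegree_fls_to_fps_gt0[of F] by simp
  then show ?thesis by (simp add: sigma_eq_fls_subst fls_subst_def)
qed

lemma coeff_compose_Tser:
  assumes n: "1 \<le> n" and k: "1 \<le> k"
  shows "poly.coeff ((fps_map (\<lambda>c::'a::comm_ring_1. [:c:]) F oo Tser n k) $ m) j =
    (if k * j \<le> m \<and> n dvd (m - k * j) then of_nat (((m - k * j) div n) choose j) * F $ ((m - k * j) div n) else 0)"
proof -
  have Tp: "(Tser n k :: 'a poly fps) ^ i = fps_X ^ (n * i) * unit_series k ^ i" for i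
    by (simp add: Tser_def power_mult_distrib power_mult)
  have c: "(m \<ge> n * i \<and> m - n * i = k * j) \<longleftrightarrow> (k * j \<le> m \<and> n dvd (m - k * j) \<and> i = (m - k * j) div n)" for i
  proof
    assume a: "m \<ge> n * i \<and> m - n * i = k * j"
    then have "m - k * j = n * i" by auto
    then show "k * j \<le> m \<and> n dvd (m - k * j) \<and> i = (m - k * j) div n" using a n by auto
  next
    assume a: "k * j \<le> m \<and> n dvd (m - k * j) \<and> i = (m - k * j) div n"
    then have "m - k * j = n * i" by auto
    then show "m \<ge> n * i \<and> m - n * i = k * j" using a by auto
  qed
  have "poly.coeff ((fps_map (\<lambda>c. [:c:]) F oo Tser n k) $ m) j =
      (\<Sum>i=0..m. F $ i * poly.coeff ((fps_X ^ (n * i) * unit_series k ^ i) $ m) j)"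
    by (simp add: fps_compose_nth coeff_sum Tp)
  also have "\<dots> = (\<Sum>i=0..m. if m \<ge> n * i \<and> m - n * i = k * j then F $ i * of_nat (i choose j) else 0)"
  proof (rule sum.cong[OF refl])
    fix i
    show "F $ i * poly.coeff ((fps_X ^ (n * i) * unit_series k ^ i) $ m) j =
      (if m \<ge> n * i \<and> m - n * i = k * j then F $ i * of_nat (i choose j) else 0)"
    proof (cases "m < n * i")
      case True then show ?thesis by (simp add: fps_X_power_mult_nth)
    next
      case False then show ?thesis by (simp add: fps_X_power_mult_nth coeff_unit_series_power[OF k])
    qed
  qed
  also have "\<dots> = (\<Sum>i=0..m. if k * j \<le> m \<and> n dvd (m - k * j) \<and> i = (m - k * j) div n then F $ i * of_nat (i choose j) else 0)"
    by (simp only: c)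
  also have "\<dots> = (if k * j \<le> m \<and> n dvd (m - k * j) then of_nat (((m - k * j) div n) choose j) * F $ ((m - k * j) div n) else 0)"
  proof (cases "k * j \<le> m \<and> n dvd (m - k * j)")
    case True
    have "(m - k * j) div n \<le> m" by (meson diff_le_self div_le_dividend order_trans)
    then show ?thesis using True by (simp add: mult.commute)
  next
    case False
    then show ?thesis by (auto intro: sum.neutral)
  qed
  finally show ?thesis .
qed

(* Taylor's formula F(t(1 + u t^k)) = \<Sum>_j u^j t^{kj} theta_j F, read in y = t^{1/n}. *)
lemma fls_ucoeff_sigma_fps:
  assumes n: "1 \<le> n" and k: "1 \<le> k"
  shows "fls_ucoeff j (sigma n k (fps_to_fls F)) = fls_shift (- int (k * j)) (fls_spread n (fps_to_fls (fps_theta j (F :: 'a::comm_ring_1 fps))))"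
proof (rule fls_eqI)
  fix p
  show "fls_ucoeff j (sigma n k (fps_to_fls F)) $$ p = fls_shift (- int (k * j)) (fls_spread n (fps_to_fls (fps_theta j F))) $$ p"
  proof (cases "p < 0")
    case True
    have nn: "0 \<le> int (k * j)" by simp
    have "\<not> (int n dvd p - int (k * j) \<and> 0 \<le> (p - int (k * j)) div int n)"
    proof
      assume a: "int n dvd p - int (k * j) \<and> 0 \<le> (p - int (k * j)) div int n"
      then have "0 \<le> p - int (k * j)" using n by (auto simp: pos_imp_zdiv_nonneg_iff simp del: of_nat_mult)
      then show False using True nn by linarith
    qed
    then show ?thesis using True n k
      by (auto simp: sigma_fps fls_spread_nth)
  next
    case False
    define m where "m = nat p"
    have p: "p = int m" using False m_def by simp
    show ?thesis
    proof (cases "k * j \<le> m \<and> n dvd (m - k * j)")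
      case True
      then obtain s where s: "m - k * j = n * s" by blast
      have "int (m - k * j) = int m - int (k * j)" using True by (simp add: of_nat_diff)
      then have "p - int (k * j) = int n * int s" using s p by (metis of_nat_mult)
      then show ?thesis using True s n k
        by (simp add: sigma_fps fls_spread_nth p coeff_compose_Tser del: of_nat_mult)
    next
      case False
      have nd: "\<not> (int n dvd p - int (k * j) \<and> 0 \<le> (p - int (k * j)) div int n)"
      proof
        assume a: "int n dvd p - int (k * j) \<and> 0 \<le> (p - int (k * j)) div int n"
        then have "0 \<le> p - int (k * j)" using n by (auto simp: pos_imp_zdiv_nonneg_iff)
        then have km: "k * j \<le> m" using p by (simp del: of_nat_mult add: of_nat_mult[symmetric])
        then have "p - int (k * j) = int (m - k * j)" using p by simp
        then have "n dvd (m - k * j)" using a by (metis int_dvd_int_iff)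
        then show False using False km by simp
      qed
      show ?thesis using False nd n k
        by (auto simp: sigma_fps fls_spread_nth p coeff_compose_Tser)
    qed
  qed
qed

section \<open>The quotient g^{-1} sigma(g)\<close>

no_notation fps_nth (infixl \<open>$\<close> 75)

(* With g = t^{-e} G: shifted_mat e g = G, shifted_inv e g = t^e g^{-1},
  theta_quot j e g = g^{-1} t^{-e} theta_j(G) and scaled_quot n k e g = (1 + u t^{k/n})^e g^{-1} sigma(g). *)
definition shifted_mat :: "nat \<Rightarrow> 'a::comm_ring_1 fls^'n::finite^'n \<Rightarrow> 'a fls^'n^'n" where
  "shifted_mat e g = map_matrix (fls_shift (- int e)) g"

definition shifted_inv :: "nat \<Rightarrow> 'a::comm_ring_1 fls^'n::finite^'n \<Rightarrow> 'a fls^'n^'n" where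
  "shifted_inv e g = map_matrix (fls_shift (int e)) (matrix_inv g)"

definition theta_quot :: "nat \<Rightarrow> nat \<Rightarrow> 'a::comm_ring_1 fls^'n::finite^'n \<Rightarrow> 'a fls^'n^'n" where
  "theta_quot j e g = shifted_inv e g ** map_matrix (\<lambda>x. fps_to_fls (fps_theta j (fls_regpart x))) (shifted_mat e g)"

definition scaled_quot :: "nat \<Rightarrow> nat \<Rightarrow> nat \<Rightarrow> 'a::comm_ring_1 fls^'n::finite^'n \<Rightarrow> 'a poly fls^'n^'n" where
  "scaled_quot n k e g = map_matrix (\<lambda>x. fps_to_fls (unit_series k ^ e) * x) (quot n k g)"

definition subdegree_bound :: "nat \<Rightarrow> 'a::comm_ring_1 fls^'n::finite^'n \<Rightarrow> bool" where
  "subdegree_bound e g \<longleftrightarrow> (\<forall>a b. - int e \<le> fls_subdegree (g $ a $ b))"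

lemma subdegree_bound_exists: "\<exists>e. subdegree_bound e (g :: 'a::comm_ring_1 fls^'n::finite^'n)"
proof -
  define e where "e = (\<Sum>ab\<in>UNIV. nat (- fls_subdegree (g $ fst ab $ snd ab)))"
  have le: "nat (- fls_subdegree (g $ a $ b)) \<le> e" for a b
    unfolding e_def using member_le_sum[of "(a,b)" UNIV "\<lambda>ab. nat (- fls_subdegree (g $ fst ab $ snd ab))"] by simp
  have "subdegree_bound e g" unfolding subdegree_bound_def
  proof (intro allI)
    fix a b
    have "- fls_subdegree (g $ a $ b) \<le> int (nat (- fls_subdegree (g $ a $ b)))" by simp
    also have "\<dots> \<le> int e" using le[of a b] by (simp only: of_nat_le_iff)
    finally show "- int e \<le> fls_subdegree (g $ a $ b)" by simp
  qed
  then show ?thesis by blast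
qed

lemma shifted_mat_subdegree: "subdegree_bound e g \<Longrightarrow> 0 \<le> fls_subdegree (shifted_mat e g $ a $ b)"
  unfolding shifted_mat_def subdegree_bound_def by (auto intro: fls_shift_nonneg_subdegree)

lemma shifted_mat_fps: "subdegree_bound e g \<Longrightarrow> fps_to_fls (fls_regpart (shifted_mat e g $ a $ b)) = shifted_mat e g $ a $ b"
  by (simp add: shifted_mat_subdegree)

lemma fls_shift_sum: "fls_shift m (sum f S) = (\<Sum>i\<in>S. fls_shift m (f i))"
  by (induct S rule: infinite_finite_induct) simp_all

lemma scaled_quot_formula:
  fixes g :: "'a::comm_ring_1 fls^'n::finite^'n"
  assumes n: "1 \<le> n" and k: "1 \<le> k" and eb: "subdegree_bound e g"
  shows "scaled_quot n k e g $ a $ b = (\<Sum>l\<in>UNIV. iota n (shifted_inv e g $ a $ l) * sigma n k (shifted_mat e g $ l $ b))"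
proof -
  have I: "is_ring_hom (iota n :: 'a fls \<Rightarrow> 'a poly fls)" by (rule is_ring_hom_iota[OF n])
  have Sg: "is_ring_hom (sigma n k :: 'a fls \<Rightarrow> 'a poly fls)" by (rule is_ring_hom_sigma[OF n k])
  define u where "u = sigma n k (fls_X_inv :: 'a fls)"
  have sX: "sigma n k (fls_X :: 'a fls) = fls_X ^ n * fps_to_fls (unit_series k)"
    using sigma_X[OF n k] by (simp add: Tser_def fls_times_fps_to_fls fps_to_fls_power)
  have key: "fps_to_fls (unit_series k ^ e) * (fls_X ^ (n * e) * u ^ e) = (1 :: 'a poly fls)"
  proof -
    have "u * sigma n k fls_X = 1" unfolding u_def
      by (simp add: is_ring_homD(4)[OF Sg, symmetric] fls_X_inv_times_conv_shift is_ring_homD(2)[OF Sg])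
    then have "(fps_to_fls (unit_series k) * fls_X ^ n * u) ^ e = 1" by (simp add: sX mult_ac)
    then show ?thesis by (simp add: power_mult_distrib fls_times_fps_to_fls fps_to_fls_power mult_ac flip: power_mult)
  qed
  have gi: "matrix_inv g $ a $ l = fls_X ^ e * shifted_inv e g $ a $ l" for l
    by (simp add: shifted_inv_def fls_X_power_times_conv_shift)
  have gg: "g $ l $ b = fls_X_inv ^ e * shifted_mat e g $ l $ b" for l
    by (simp add: shifted_mat_def fls_X_inv_power_times_conv_shift)
  have trm: "fps_to_fls (unit_series k ^ e) * (iota n (matrix_inv g $ a $ l) * sigma n k (g $ l $ b)) =
       iota n (shifted_inv e g $ a $ l) * sigma n k (shifted_mat e g $ l $ b)" for l
  proof -
    have "iota n (matrix_inv g $ a $ l) = fls_X ^ (n * e) * iota n (shifted_inv e g $ a $ l)"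
      by (simp add: gi is_ring_homD(4)[OF I] ring_hom_power[OF I] iota_X[OF n] power_mult)
    moreover have "sigma n k (g $ l $ b) = u ^ e * sigma n k (shifted_mat e g $ l $ b)"
      by (simp add: gg is_ring_homD(4)[OF Sg] ring_hom_power[OF Sg] u_def)
    moreover have "fps_to_fls (unit_series k ^ e) * (fls_X ^ (n * e) * A * (u ^ e * B)) =
        (fps_to_fls (unit_series k ^ e) * (fls_X ^ (n * e) * u ^ e)) * (A * B)" for A B :: "'a poly fls"
      by (simp only: mult_ac)
    ultimately show ?thesis using key by simp
  qed
  have "scaled_quot n k e g $ a $ b = fps_to_fls (unit_series k ^ e) * (\<Sum>l\<in>UNIV. iota n (matrix_inv g $ a $ l) * sigma n k (g $ l $ b))"
    by (simp add: scaled_quot_def quot_def matrix_matrix_mult_def)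
  also have "\<dots> = (\<Sum>l\<in>UNIV. iota n (shifted_inv e g $ a $ l) * sigma n k (shifted_mat e g $ l $ b))"
    by (simp add: sum_distrib_left trm)
  finally show ?thesis .
qed

lemma fls_ucoeff_scaled_quot:
  fixes g :: "'a::comm_ring_1 fls^'n::finite^'n"
  assumes n: "1 \<le> n" and k: "1 \<le> k" and eb: "subdegree_bound e g"
  shows "fls_ucoeff j (scaled_quot n k e g $ a $ b) = fls_shift (- int (k * j)) (fls_spread n (theta_quot j e g $ a $ b))"
proof -
  have SP: "is_ring_hom (fls_spread n :: 'a fls \<Rightarrow> 'a fls)" by (rule is_ring_hom_fls_spread[OF n])
  have "fls_ucoeff j (scaled_quot n k e g $ a $ b) = (\<Sum>l\<in>UNIV. fls_ucoeff j (iota n (shifted_inv e g $ a $ l) * sigma n k (shifted_mat e g $ l $ b)))"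
    by (simp add: scaled_quot_formula[OF n k eb] fls_ucoeff_sum)
  also have "\<dots> = (\<Sum>l\<in>UNIV. fls_spread n (shifted_inv e g $ a $ l) * fls_shift (- int (k * j))
       (fls_spread n (fps_to_fls (fps_theta j (fls_regpart (shifted_mat e g $ l $ b))))))"
  proof (rule sum.cong[OF refl])
    fix l
    have "sigma n k (shifted_mat e g $ l $ b) = sigma n k (fps_to_fls (fls_regpart (shifted_mat e g $ l $ b)))"
      by (simp add: shifted_mat_fps[OF eb])
    then show "fls_ucoeff j (iota n (shifted_inv e g $ a $ l) * sigma n k (shifted_mat e g $ l $ b)) = fls_spread n (shifted_inv e g $ a $ l) * fls_shift (- int (k * j))
       (fls_spread n (fps_to_fls (fps_theta j (fls_regpart (shifted_mat e g $ l $ b)))))"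
      by (simp add: iota_eq_fls_spread[OF n] fls_ucoeff_const_poly_mult fls_ucoeff_sigma_fps[OF n k])
  qed
  also have "\<dots> = (\<Sum>l\<in>UNIV. fls_shift (- int (k * j)) (fls_spread n (shifted_inv e g $ a $ l *
       fps_to_fls (fps_theta j (fls_regpart (shifted_mat e g $ l $ b))))))"
    by (rule sum.cong[OF refl]) (simp only: is_ring_homD(4)[OF SP] fls_shifted_times_simps)
  also have "\<dots> = fls_shift (- int (k * j)) (fls_spread n (\<Sum>l\<in>UNIV. shifted_inv e g $ a $ l *
       fps_to_fls (fps_theta j (fls_regpart (shifted_mat e g $ l $ b)))))"
    by (simp only: fls_shift_sum ring_hom_sum[OF SP])
  also have "\<dots> = fls_shift (- int (k * j)) (fls_spread n (theta_quot j e g $ a $ b))"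
    by (simp only: theta_quot_def matrix_matrix_mult_def vec_lambda_beta nth_map_matrix)
  finally show ?thesis .
qed

lemma theta_quot_0:
  fixes g :: "'a::comm_ring_1 fls^'n::finite^'n"
  assumes eb: "subdegree_bound e g" and inv: "matrix_inv g ** g = mat 1"
  shows "theta_quot 0 e g = mat 1"
proof -
  have "theta_quot 0 e g $ a $ b = (\<Sum>l\<in>UNIV. shifted_inv e g $ a $ l * shifted_mat e g $ l $ b)" for a b
    by (simp add: theta_quot_def matrix_matrix_mult_def shifted_mat_fps[OF eb])
  also have "\<dots> a b = (matrix_inv g ** g) $ a $ b" for a b
    by (simp add: matrix_matrix_mult_def shifted_inv_def shifted_mat_def fls_times_both_shifted_simp)
  finally have "theta_quot 0 e g $ a $ b = (matrix_inv g ** g) $ a $ b" for a b .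
  then show ?thesis using inv by (simp add: vec_eq_iff)
qed

definition fls_integral :: "'a::zero fls \<Rightarrow> bool" where
  "fls_integral Y \<longleftrightarrow> (\<forall>p<0. Y $$ p = 0)"

lemma fls_integral_mult: "fls_integral (A::'a::comm_ring_1 fls) \<Longrightarrow> fls_integral B \<Longrightarrow> fls_integral (A * B)"
  unfolding fls_integral_def using fls_times_nth_neg by blast

lemma fls_integral_fps_to_fls: "fls_integral (fps_to_fls F)"
  by (simp add: fls_integral_def)

lemma fls_integral_subdegree: "fls_integral Y \<Longrightarrow> 0 \<le> fls_subdegree Y"
  unfolding fls_integral_def by (cases "Y = 0") (auto intro: fls_subdegree_geI)

lemma coeff_scaled_quot_nth:
  fixes g :: "'a::comm_ring_1 fls^'n::finite^'n"
  assumes n: "1 \<le> n" and k: "1 \<le> k" and eb: "subdegree_bound e g"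
  shows "poly.coeff (scaled_quot n k e g $ a $ b $$ p) j =
    (if int n dvd (p - int (k * j)) then theta_quot j e g $ a $ b $$ ((p - int (k * j)) div int n) else 0)"
proof -
  have "poly.coeff (scaled_quot n k e g $ a $ b $$ p) j = fls_ucoeff j (scaled_quot n k e g $ a $ b) $$ p" by simp
  also have "\<dots> = fls_spread n (theta_quot j e g $ a $ b) $$ (p - int (k * j))"
    by (simp add: fls_ucoeff_scaled_quot[OF n k eb])
  finally show ?thesis by (simp add: fls_spread_nth[OF n])
qed

lemma theta_quot_bounded_below:
  fixes g :: "'a::comm_ring_1 fls^'n::finite^'n"
  shows "\<exists>c::nat. \<forall>j a b l. l < - int c \<longrightarrow> theta_quot j e g $ a $ b $$ l = 0"
proof -
  obtain c where c: "subdegree_bound c (shifted_inv e g)" using subdegree_bound_exists by blast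
  have "theta_quot j e g $ a $ b $$ l = 0" if l: "l < - int c" for j a b l
  proof -
    have "(shifted_inv e g $ a $ m * fps_to_fls (fps_theta j (fls_regpart (shifted_mat e g $ m $ b)))) $$ l = 0" for m
    proof -
      have "(shifted_inv e g $ a $ m * fps_to_fls (fps_theta j (fls_regpart (shifted_mat e g $ m $ b)))) $$ l =
        (\<Sum>i=- int c..l-0. shifted_inv e g $ a $ m $$ i * fps_to_fls (fps_theta j (fls_regpart (shifted_mat e g $ m $ b))) $$ (l - i))"
      proof (rule fls_times_nth_bounds)
        fix i assume "i < - int c"
        moreover have "- int c \<le> fls_subdegree (shifted_inv e g $ a $ m)" using c by (simp add: subdegree_bound_def)
        ultimately show "shifted_inv e g $ a $ m $$ i = 0" by simp
      qed simp
      then show ?thesis using l by simp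
    qed
    then show ?thesis by (simp add: theta_quot_def matrix_matrix_mult_def fls_nth_sum)
  qed
  then show ?thesis by blast
qed

lemma quot_eq_scaled_quot:
  fixes g :: "'a::comm_ring_1 fls^'n::finite^'n"
  assumes k: "1 \<le> k"
  shows "quot n k g $ a $ b = fps_to_fls (Winv k ^ e) * scaled_quot n k e g $ a $ b"
proof -
  have "fps_to_fls (Winv k ^ e) * fps_to_fls (unit_series k ^ e) = (1 :: 'a poly fls)"
    by (simp add: fls_times_fps_to_fls[symmetric] power_mult_distrib[symmetric] mult.commute[of "Winv k"] unit_series_Winv[OF k])
  then show ?thesis by (simp add: scaled_quot_def mult.assoc[symmetric])
qed

lemma G_points_quot:
  fixes I :: "('n::finite \<times> 'n, 'a::comm_ring_1) mpoly set" and g :: "'a fls^'n^'n"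
  assumes S: "subgroup_scheme_SL I" and gG: "G_points fls_const I g" and n: "1 \<le> n" and k: "1 \<le> k"
  shows "G_points (\<lambda>c. fls_const [:c:]) I (quot n k g)"
proof -
  have R2: "is_ring_hom (\<lambda>c::'a. (fls_const [:c:] :: 'a poly fls))"
    using is_ring_hom_comp[OF is_ring_hom_const_poly is_ring_hom_fls_const] by (simp add: comp_def)
  have gi: "G_points fls_const I (matrix_inv g)" by (rule G_points_matrix_inv[OF is_ring_hom_fls_const S gG])
  have e1: "iota n \<circ> fls_const = (\<lambda>c::'a. fls_const [:c:])"
    by (rule ext) (simp add: iota_const[OF n])
  have e2: "sigma n k \<circ> fls_const = (\<lambda>c::'a. fls_const [:c:])"
    by (rule ext) (simp add: sigma_const[OF n k])
  have A: "G_points (\<lambda>c. fls_const [:c:]) I (map_matrix (iota n) (matrix_inv g))"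
    using G_points_map[OF is_ring_hom_iota[OF n] gi] unfolding e1 .
  have B: "G_points (\<lambda>c. fls_const [:c:]) I (map_matrix (sigma n k) g)"
    using G_points_map[OF is_ring_hom_sigma[OF n k] gG] unfolding e2 .
  have "quot n k g = map_matrix (iota n) (matrix_inv g) ** map_matrix (sigma n k) g"
    by (simp add: quot_def map_matrix_def)
  then show ?thesis using G_points_mult[OF R2 S A B] by simp
qed

lemma G_points_regpart:
  fixes I :: "('n::finite \<times> 'n, 'a::comm_ring_1) mpoly set" and x :: "'a poly fls^'n^'n"
  assumes G: "G_points (\<lambda>c. fls_const [:c:]) I x" and int: "\<And>a b. fls_integral (x $ a $ b)"
  shows "x = (\<chi> i j. fps_to_fls (map_matrix fls_regpart x $ i $ j))"
    and "G_points (\<lambda>c. fps_const [:c:]) I (map_matrix fls_regpart x)"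
proof -
  show "x = (\<chi> i j. fps_to_fls (map_matrix fls_regpart x $ i $ j))"
    using fls_integral_subdegree[OF int] by (simp add: vec_eq_iff)
  have m: "map_matrix fps_to_fls (map_matrix fls_regpart x) = x"
    using fls_integral_subdegree[OF int] by (simp add: vec_eq_iff)
  have c: "fps_to_fls \<circ> (\<lambda>c. fps_const [:c:]) = (\<lambda>c::'a. fls_const [:c:])"
    by (rule ext) simp
  show "G_points (\<lambda>c. fps_const [:c:]) I (map_matrix fls_regpart x)"
    by (rule G_points_reflect[OF is_ring_hom_fps_to_fls]) (use G in \<open>simp_all add: c m inj_def\<close>)
qed

lemma fls_nth_mat_1: "(mat 1 :: 'a::comm_ring_1 fls^'n^'n) $ a $ b $$ p = (if a = b \<and> p = 0 then 1 else 0)"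
  by (simp add: mat_def)

lemma fps_mult_nth_cong:
  fixes A B A' B' :: "'b::comm_ring_1 fps"
  assumes "\<And>l. l < M \<Longrightarrow> fps_nth A l = fps_nth A' l" "\<And>l. l < M \<Longrightarrow> fps_nth B l = fps_nth B' l" "l < M"
  shows "fps_nth (A * B) l = fps_nth (A' * B') l"
  using assms by (simp add: fps_mult_nth)

lemma Winv_nth_low:
  assumes k: "1 \<le> k" and l: "l < k"
  shows "fps_nth (Winv k :: 'a::comm_ring_1 poly fps) l = fps_nth 1 l"
proof -
  have "Winv k + fps_const [:0, 1:] * (fps_X ^ k * Winv k) = (1 :: 'a poly fps)"
    using unit_series_Winv[OF k] by (simp add: algebra_simps)
  then have "fps_nth (Winv k + fps_const [:0, 1:] * (fps_X ^ k * Winv k)) l = fps_nth (1 :: 'a poly fps) l" by simp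
  then show ?thesis using l by (simp add: fps_X_power_mult_nth)
qed

lemma Winv_power_nth_low:
  assumes k: "1 \<le> k" and l: "l < k"
  shows "fps_nth (Winv k ^ e :: 'a::comm_ring_1 poly fps) l = fps_nth 1 l"
  using l
proof (induct e arbitrary: l)
  case 0 then show ?case by simp
next
  case (Suc e)
  have "fps_nth (Winv k * Winv k ^ e :: 'a poly fps) l = fps_nth (1 * 1 :: 'a poly fps) l"
    by (rule fps_mult_nth_cong[of k, OF Winv_nth_low[OF k] Suc.hyps Suc.prems])
  then show ?case by simp
qed

lemma scaled_quot_nth_low:
  fixes g :: "'a::comm_ring_1 fls^'n::finite^'n" and M :: int
  assumes n: "1 \<le> n" and v: "1 \<le> v" and eb: "subdegree_bound e g" and dg: "det g = 1"
    and vanish: "\<And>j a b l. 1 \<le> j \<Longrightarrow> int n * l + int (v * j) < M \<Longrightarrow> theta_quot j e g $ a $ b $$ l = 0"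
    and p: "p < M"
  shows "scaled_quot n v e g $ a $ b $$ p = (if a = b \<and> p = 0 then 1 else 0)"
proof (rule poly_eqI)
  have H0: "theta_quot 0 e g = mat 1" using theta_quot_0[OF eb] det_eq_1_matrix_inv[OF dg] by simp
  fix j
  show "poly.coeff (scaled_quot n v e g $ a $ b $$ p) j = poly.coeff (if a = b \<and> p = 0 then 1 else 0) j"
  proof (cases "j = 0")
    case True
    have "int n dvd p \<Longrightarrow> (p div int n = 0 \<longleftrightarrow> p = 0)" using n by auto
    then show ?thesis using True n
      by (auto simp: coeff_scaled_quot_nth[OF n v eb] H0 fls_nth_mat_1)
  next
    case False
    have "theta_quot j e g $ a $ b $$ ((p - int (v * j)) div int n) = 0" if d: "int n dvd p - int (v * j)"
    proof (rule vanish)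
      show "1 \<le> j" using False by simp
      have "int n * ((p - int (v * j)) div int n) = p - int (v * j)" using d by simp
      then show "int n * ((p - int (v * j)) div int n) + int (v * j) < M" using p by simp
    qed
    then show ?thesis using False by (simp add: coeff_scaled_quot_nth[OF n v eb] del: of_nat_mult)
  qed
qed

lemma in_kernel_quot:
  fixes I :: "('n::finite \<times> 'n, 'a::comm_ring_1) mpoly set" and g :: "'a fls^'n^'n"
  assumes S: "subgroup_scheme_SL I" and gG: "G_points fls_const I g"
    and n: "1 \<le> n" and v: "1 \<le> v" and Mv: "M \<le> v" and eb: "subdegree_bound e g"
    and vanish: "\<And>j a b l. 1 \<le> j \<Longrightarrow> int n * l + int (v * j) < int M \<Longrightarrow> theta_quot j e g $ a $ b $$ l = 0"
  shows "in_kernel I M (quot n v g)"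
proof -
  have dg: "det g = 1" using gG by (simp add: G_points_def)
  note Qlow = scaled_quot_nth_low[OF n v eb dg vanish]
  have Qint: "fls_integral (scaled_quot n v e g $ a $ b)" for a b
    unfolding fls_integral_def using Qlow[where a = a and b = b] by simp
  have qint: "fls_integral (quot n v g $ a $ b)" for a b
    unfolding quot_eq_scaled_quot[OF v, of n g a b e]
    by (rule fls_integral_mult[OF fls_integral_fps_to_fls Qint])
  define h where "h = map_matrix fls_regpart (quot n v g)"
  have hx: "quot n v g = (\<chi> i j. fps_to_fls (h $ i $ j))"
    and hG: "G_points (\<lambda>c. fps_const [:c:]) I h"
    using G_points_regpart[OF G_points_quot[OF S gG n v] qint] unfolding h_def by auto
  have ker: "fps_nth ((h - mat 1) $ i $ j) l = 0" if l: "l < M" for i j l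
  proof -
    define Qf where "Qf = fls_regpart (scaled_quot n v e g $ i $ j)"
    have Qf: "fps_to_fls Qf = scaled_quot n v e g $ i $ j"
      unfolding Qf_def using fls_integral_subdegree[OF Qint] by simp
    have hij: "h $ i $ j = Winv v ^ e * Qf"
      unfolding h_def
      by (simp add: quot_eq_scaled_quot[OF v, of n g i j e] Qf[symmetric] fls_times_fps_to_fls[symmetric])
    have cQ: "fps_nth Qf l' = fps_nth ((mat 1 :: 'a poly fps^'n^'n) $ i $ j) l'" if "l' < M" for l'
      using Qlow[where p = "int l'" and a = i and b = j] that by (simp add: Qf_def mat_def)
    have cW: "fps_nth (Winv v ^ e :: 'a poly fps) l' = fps_nth 1 l'" if "l' < M" for l'
      by (rule Winv_power_nth_low[OF v]) (use that Mv in simp)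
    have "fps_nth (Winv v ^ e * Qf) l = fps_nth (1 * (mat 1 :: 'a poly fps^'n^'n) $ i $ j) l"
      by (rule fps_mult_nth_cong[of M]) (use cQ cW l in auto)
    then show ?thesis by (simp add: hij)
  qed
  show ?thesis unfolding in_kernel_def using hx hG ker by blast
qed

lemma in_G_Ar_of_in_kernel: "in_kernel I M x \<Longrightarrow> in_G_Ar I x"
  unfolding in_kernel_def in_G_Ar_def by blast

(* The H_j are bounded below uniformly in j, so for large k the quotient for t \<mapsto> t(1 + u t^k)
  is integral: the set whose infimum is r(g) is non-empty. *)
lemma exists_integral_quot:
  fixes I :: "('n::finite \<times> 'n, 'a::comm_ring_1) mpoly set" and g :: "'a fls^'n^'n"
  assumes S: "subgroup_scheme_SL I" and gG: "G_points fls_const I g"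
  shows "\<exists>k\<ge>1. in_G_Ar I (quot 1 k g)"
proof -
  obtain e where eb: "subdegree_bound e g" using subdegree_bound_exists by blast
  obtain c where hc: "\<And>j a b l. l < - int c \<Longrightarrow> theta_quot j e g $ a $ b $$ l = 0"
    using theta_quot_bounded_below[of e g] by blast
  have "in_kernel I 0 (quot 1 (c + 1) g)"
  proof (rule in_kernel_quot[OF S gG order_refl _ _ eb])
    fix j a b l
    assume j: "1 \<le> j" and l: "int 1 * l + int ((c + 1) * j) < int 0"
    have "c + 1 \<le> (c + 1) * j" using j by (metis mult.right_neutral mult_le_mono2)
    then have "int (c + 1) \<le> int ((c + 1) * j)" by (simp only: of_nat_le_iff)
    then have "l < - int c" using l by linarith
    then show "theta_quot j e g $ a $ b $$ l = 0" by (rule hc)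
  qed simp_all
  then have "in_G_Ar I (quot 1 (c + 1) g)" by (rule in_G_Ar_of_in_kernel)
  then show ?thesis by (intro exI[of _ "c + 1"]) simp
qed

lemma theta_quot_vanish_of_integral:
  fixes I :: "('n::finite \<times> 'n, 'a::comm_ring_1) mpoly set" and g :: "'a fls^'n^'n"
  assumes n: "1 \<le> n" and k: "1 \<le> k" and eb: "subdegree_bound e g"
    and int: "in_G_Ar I (quot n k g)" and l: "int n * l + int (k * j) < 0"
  shows "theta_quot j e g $ a $ b $$ l = 0"
proof -
  obtain h where h: "quot n k g = (\<chi> i j. fps_to_fls (h $ i $ j))"
    using int unfolding in_G_Ar_def by blast
  have "fls_integral (scaled_quot n k e g $ a $ b)"
    by (simp add: scaled_quot_def h fls_integral_mult fls_integral_fps_to_fls)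
  then have "poly.coeff (scaled_quot n k e g $ a $ b $$ (int n * l + int (k * j))) j = 0"
    using l unfolding fls_integral_def by simp
  then show ?thesis using n by (simp add: coeff_scaled_quot_nth[OF n k eb] del: of_nat_mult)
qed

lemma slope_bound:
  fixes m n m' n' M v j l :: int
  assumes n: "0 < n" and n': "0 < n'" and r: "m' * n < (m + 1) * n'" and j: "1 \<le> j" and M: "1 \<le> M"
    and v: "m + M \<le> v" and h: "n * l + v * j < M"
  shows "n' * l + m' * j < 0"
proof (rule ccontr)
  assume "\<not> n' * l + m' * j < 0"
  then have "0 \<le> n * (n' * l + m' * j)" using n by simp
  moreover have "(m' * n) * j < ((m + 1) * n') * j" using r j by (simp add: mult_strict_right_mono)
  ultimately have "n' * (- (m + 1) * j) < n' * (n * l)" by (simp add: algebra_simps)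
  then have "- (m + 1) * j < n * l" using n' by (simp add: mult_less_cancel_left_pos)
  moreover have "(m + M) * j \<le> v * j" using v j by (simp add: mult_right_mono)
  moreover have "0 \<le> (M - 1) * (j - 1)" using M j by simp
  ultimately show False using h by (simp add: algebra_simps)
qed

lemma index_witness:
  fixes I :: "('n::finite \<times> 'n, 'a::comm_ring_1) mpoly set" and g :: "'a fls^'n^'n"
  assumes S: "subgroup_scheme_SL I" and gG: "G_points fls_const I g" and nG: "\<not> in_G_fps I g"
    and n: "1 \<le> n" and r: "rindex I g = real m / real n"
  obtains m' n' where "1 \<le> m'" "1 \<le> n'" "in_G_Ar I (quot n' m' g)"
    and "int m' * int n < (int m + 1) * int n'"
proof -
  define R where "R = {real m / real n |m n. 0 < m \<and> 0 < n \<and> coprime m n \<and> in_G_Ar I (quot n m g)}"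
  obtain k where "1 \<le> k" "in_G_Ar I (quot 1 k g)" using exists_integral_quot[OF S gG] by blast
  then have "real k / real (1::nat) \<in> R" unfolding R_def by fastforce
  then have ne: "R \<noteq> {}" by blast
  have "Inf R < real m / real n + 1 / real n"
    using r nG n by (simp add: rindex_def R_def)
  then obtain m' n' where mn': "0 < m'" "0 < n'" "in_G_Ar I (quot n' m' g)"
    and "real m' / real n' < real m / real n + 1 / real n"
    using cInf_lessD[OF ne] unfolding R_def by blast
  then have "real m' * real n < (real m + 1) * real n'"
    using n by (simp add: field_simps)
  then have "real_of_int (int m' * int n) < real_of_int ((int m + 1) * int n')" by simp
  then have "int m' * int n < (int m + 1) * int n'" by (simp only: of_int_less_iff)
  with mn' show ?thesis by (intro that) auto
qed

lemma in_kernel_quot_above_index: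
  fixes I :: "('n::finite \<times> 'n, 'a::comm_ring_1) mpoly set" and g :: "'a fls^'n^'n" and M :: nat
  assumes S: "subgroup_scheme_SL I" and gG: "G_points fls_const I g" and nG: "\<not> in_G_fps I g"
    and M: "0 < M" and n: "1 \<le> n" and r: "rindex I g = real m / real n" and v: "m + M \<le> v"
  shows "in_kernel I M (quot n v g)"
proof -
  obtain m' n' where m': "1 \<le> m'" and n': "1 \<le> n'" and int: "in_G_Ar I (quot n' m' g)"
    and slope: "int m' * int n < (int m + 1) * int n'"
    using index_witness[OF S gG nG n r] .
  obtain e where eb: "subdegree_bound e g" using subdegree_bound_exists by blast
  show ?thesis
  proof (rule in_kernel_quot[OF S gG n _ _ eb])
    fix j a b l
    assume "1 \<le> j" "int n * l + int (v * j) < int M"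
    then have "int n' * l + int m' * int j < 0"
      using slope_bound[of "int n" "int n'" "int m'" "int m" "int j" "int M" "int v"] n n' slope M v by simp
    then show "theta_quot j e g $ a $ b $$ l = 0"
      by (intro theta_quot_vanish_of_integral[OF n' m' eb int]) simp
  qed (use M v in simp_all)
qed

theorem mainTheorem14:
  fixes I :: "('n::finite \<times> 'n, 'a::comm_ring_1) mpoly set"
    and g :: "'a fls^'n^'n" and M :: nat
  assumes "subgroup_scheme_SL I"
    and "G_points fls_const I g"
    and "\<not> in_G_fps I g"
    and "0 < M"
  shows "(\<forall>m n v. 1 \<le> n \<and> coprime m n \<and> rindex I g = real m / real n \<and> m + M \<le> v
            \<longrightarrow> in_kernel I M (quot n v g))
       \<and> (rindex I g = 0 \<longrightarrow> (\<forall>s. M \<le> s \<longrightarrow> in_kernel I M (quot 1 s g)))"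
proof (intro conjI allI impI)
  fix m n v :: nat
  assume "1 \<le> n \<and> coprime m n \<and> rindex I g = real m / real n \<and> m + M \<le> v"
  then show "in_kernel I M (quot n v g)"
    using in_kernel_quot_above_index[OF assms] by blast
next
  fix s :: nat
  assume "rindex I g = 0" and "M \<le> s"
  then show "in_kernel I M (quot 1 s g)"
    using in_kernel_quot_above_index[OF assms, of 1 0 s] by simp
qed

end
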